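(* Let $V$ be a vertex operator algebra over $\mathbb{C}$, let $n$ be a nonnegative integer and let $W$ be a weak $V$-module. For homogeneous $v\in V$ and $w\in W$ set $$v*_n w=\sum_{m=0}^{n}\binom{-n-1}{m}\mathrm{Res}_x\, x^{-n-m-1}(1+x)^{\mathrm{wt}\,v+n}Y(v,x)w,$$ $$w*_n v=\sum_{m=0}^{n}\binom{-n-1}{m}(-1)^{n-m}\mathrm{Res}_x\, x^{-n-m-1}(1+x)^{\mathrm{wt}\,v+m-1}Y(v,x)w,$$ extended by linearity to all $v\in V$. Then these left and right actions of $V$ on $W$ give rise to an $A_n(V)$-bimodule structure on $A'_n(W)=W/O'_n(W)$.
   Context: **Vertex operator algebra notation.** $V=(V,Y,\mathbf 1,\omega)$ is a vertex operator algebra over $\mathbb{C}$, with $Y(v,x)=\sum_{m\in\mathbb{Z}}v_m x^{-m-1}$, $Y(\omega,x)=\sum_{m\in\mathbb{Z}}L(m)x^{-m-2}$; $\mathrm{wt}\,v$ is the weight ($L(0)$-eigenvalue) of a homogeneous vector $v$. A weak $V$-module is a vector space $W$ with a linear map $v\mapsto Y_W(v,x)\in\mathrm{Hom}(W,W((x)))$ (also written $Y$) satisfying all the axioms of a module except that no grading is required. $\mathrm{Res}_x$ is the coefficient of $x^{-1}$, and $(1+x)^k$, $k\in\mathbb{Z}$, is expanded in nonnegative powers of $x$. **$O'_n(W)$.** $O'_n(W)$ is the linear span of the elements $\mathrm{Res}_x x^{-2n-2}(1+x)^{\mathrm{wt}\,v+n}Y(v,x)w$ for $w\in W$ and homogeneous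 $v\in V$. **$A_n(V)$.** $O_n(V)$ is the linear span in $V$ of the elements $(L(-1)+L(0))v$ and $\mathrm{Res}_x\frac{(1+x)^{\mathrm{wt}\,u+n}}{x^{2n+2}}Y(u,x)v$ for homogeneous $u,v\in V$. For homogeneous $u$ and $v\in V$, $u*_nv=\sum_{m=0}^n\binom{-n-1}{m}\mathrm{Res}_x\frac{(1+x)^{\mathrm{wt}\,u+n}}{x^{n+m+1}}Y(u,x)v$, extended linearly. It is known that $O_n(V)$ is a two-sided ideal of $(V,*_n)$ and that $A_n(V)=V/O_n(V)$ is an associative algebra under $*_n$ with identity $\mathbf 1+O_n(V)$. *)

theory Defs
  imports
    "HOL-Algebra.Algebraic_Closure_Type"
    "HOL-Computational_Algebra.Formal_Laurent_Series"
    "HOL-Library.Groups_Big_Fun"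
    "HOL-Library.Set_Algebras"
begin

section \<open>Vertex operator algebras and weak modules\<close>

text \<open>
  The underlying vector spaces are whole types. \<open>mode W v m\<close> is the operator \<open>v\<^sub>m\<close> on \<open>W\<close>, so
  that \<open>Y\<^sub>W(v,x)w\<close> is the sum of the \<open>(v\<^sub>m w) x^(-m-1)\<close> over all integers \<open>m\<close>. The data of a vertex
  operator algebra extend those of a weak module, so that \<open>V\<close> itself can be used as the adjoint
  module.
\<close>

record ('v, 'w) weak_module_data =
  smul :: "complex \<Rightarrow> 'w \<Rightarrow> 'w"
  mode :: "'v \<Rightarrow> int \<Rightarrow> 'w \<Rightarrow> 'w"

record 'v voa_data = "('v, 'v) weak_module_data" +
  vac :: 'v
  conf :: 'v

definition Lop :: "('v, 'z) voa_data_scheme \<Rightarrow> int \<Rightarrow> 'v \<Rightarrow> 'v" where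
  "Lop V m = mode V (conf V) (m + 1)"

definition wt_space :: "('v::ab_group_add, 'z) voa_data_scheme \<Rightarrow> int \<Rightarrow> 'v set" where
  "wt_space V k = {v. Lop V 0 v = smul V (of_int k) v}"

definition is_decomp ::
  "('v::ab_group_add, 'z) voa_data_scheme \<Rightarrow> 'v \<Rightarrow> (int \<Rightarrow> 'v) \<Rightarrow> bool" where
  "is_decomp V v f \<longleftrightarrow>
     (\<forall>k. f k \<in> wt_space V k) \<and> finite {k. f k \<noteq> 0} \<and> v = Sum_any f"

text \<open>
  The axioms of a weak module, which are also those axioms of a vertex operator algebra that make
  sense for a module. \<open>jacobi\<close> is the coefficient of \<open>x\<^sub>0^(-l-1) x\<^sub>1^(-m-1) x\<^sub>2^(-n-1)\<close> in the Jacobi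
  identity
  \<open>x\<^sub>0^(-1) \<delta>((x\<^sub>1-x\<^sub>2)/x\<^sub>0) Y(u,x\<^sub>1)Y(v,x\<^sub>2) - x\<^sub>0^(-1) \<delta>((x\<^sub>2-x\<^sub>1)/(-x\<^sub>0)) Y(v,x\<^sub>2)Y(u,x\<^sub>1)
     = x\<^sub>2^(-1) \<delta>((x\<^sub>1-x\<^sub>0)/x\<^sub>2) Y(Y(u,x\<^sub>0)v,x\<^sub>2)\<close>
  applied to \<open>w\<close>; by \<open>truncation\<close> all sums in it have finite support. The \<open>L(-1)\<close>-derivative property
  and the Virasoro relations on \<open>W\<close> follow from these axioms and those of \<open>V\<close>.
\<close>

locale weak_module =
  fixes V :: "('v::ab_group_add, 'z) voa_data_scheme"
    and W :: "('v, 'w::ab_group_add, 'y) weak_module_data_scheme"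
  assumes vector_space_V: "vector_space (smul V)"
    and vector_space_W: "vector_space (smul W)"
    and linear_state: "\<And>m w. Vector_Spaces.linear (smul V) (smul W) (\<lambda>v. mode W v m w)"
    and linear_mode: "\<And>v m. Vector_Spaces.linear (smul W) (smul W) (mode W v m)"
    and truncation: "\<And>v w. \<exists>N. \<forall>m\<ge>N. mode W v m w = 0"
    and vacuum: "\<And>m w. mode W (vac V) m w = (if m = -1 then w else 0)"
    and jacobi: "\<And>u v w l m n.
      Sum_any (\<lambda>i::nat. smul W ((-1) ^ i * (of_int l gchoose i))
        (mode W u (m + l - int i) (mode W v (n + int i) w)
          - smul W ((-1) powi l) (mode W v (n + l - int i) (mode W u (m + int i) w))))
      = Sum_any (\<lambda>i::nat. smul W (of_int m gchoose i)
          (mode W (mode V u (l + int i) v) (m + n - int i) w))"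

text \<open>
  The homogeneous subspace of weight \<open>k\<close> is the eigenspace \<open>wt_space V k\<close> of \<open>L(0)\<close>, and
  \<open>direct_sum\<close> says that \<open>V\<close> is the direct sum of these over all integers \<open>k\<close>.
\<close>

locale voa = weak_module V V for V :: "('v::ab_group_add, 'z) voa_data_scheme" +
  assumes creation: "\<And>v m. m \<ge> 0 \<Longrightarrow> mode V v m (vac V) = 0"
    and creation_lim: "\<And>v. mode V v (-1) (vac V) = v"
    and virasoro: "\<exists>c. \<forall>m n v.
      Lop V m (Lop V n v) - Lop V n (Lop V m v)
        = smul V (of_int (m - n)) (Lop V (m + n) v)
          + (if m + n = 0 then smul V (of_int (m ^ 3 - m) / 12 * c) v else 0)"
    and L_derivative: "\<And>v m u. mode V (Lop V (-1) v) m u = smul V (- of_int m) (mode V v (m - 1) u)"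
    and direct_sum: "\<And>v. \<exists>!f. is_decomp V v f"
    and finite_dim: "\<And>k. \<exists>B. finite B \<and> wt_space V k = Modules.module.span (smul V) B"
    and lower_bounded: "\<exists>N. \<forall>k<N. wt_space V k = {0}"

section \<open>The actions and the subspaces\<close>

text \<open>\<open>res_Y W f v w\<close> is the coefficient of \<open>x^(-1)\<close> in \<open>f(x) Y\<^sub>W(v,x)w\<close>.\<close>

definition res_Y ::
  "('v, 'w::ab_group_add, 'y) weak_module_data_scheme \<Rightarrow> complex fls \<Rightarrow> 'v \<Rightarrow> 'w \<Rightarrow> 'w" where
  "res_Y W f v w = Sum_any (\<lambda>k. smul W (fls_nth f k) (mode W v k w))"

text \<open>The formulas for a homogeneous \<open>v\<close> of weight \<open>k\<close>.\<close>

definition lact_wt ::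
  "('v, 'w::ab_group_add, 'y) weak_module_data_scheme \<Rightarrow> nat \<Rightarrow> int \<Rightarrow> 'v \<Rightarrow> 'w \<Rightarrow> 'w" where
  "lact_wt W n k v w = (\<Sum>m=0..n. smul W ((- of_nat n - 1) gchoose m)
     (res_Y W (fls_X powi (- int n - int m - 1) * (1 + fls_X) powi (k + int n)) v w))"

definition ract_wt ::
  "('v, 'w::ab_group_add, 'y) weak_module_data_scheme \<Rightarrow> nat \<Rightarrow> int \<Rightarrow> 'w \<Rightarrow> 'v \<Rightarrow> 'w" where
  "ract_wt W n k w v = (\<Sum>m=0..n. smul W (((- of_nat n - 1) gchoose m) * (-1) ^ (n - m))
     (res_Y W (fls_X powi (- int n - int m - 1) * (1 + fls_X) powi (k + int m - 1)) v w))"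

definition hcomp :: "('v::ab_group_add, 'z) voa_data_scheme \<Rightarrow> 'v \<Rightarrow> int \<Rightarrow> 'v" where
  "hcomp V v = (THE f. is_decomp V v f)"

text \<open>
  Linear extension in \<open>v\<close> through the homogeneous components. \<open>lact V V n\<close> is the product of \<open>V\<close>.
\<close>

definition lact :: "('v::ab_group_add, 'z) voa_data_scheme \<Rightarrow>
    ('v, 'w::ab_group_add, 'y) weak_module_data_scheme \<Rightarrow> nat \<Rightarrow> 'v \<Rightarrow> 'w \<Rightarrow> 'w" where
  "lact V W n v w = Sum_any (\<lambda>k. lact_wt W n k (hcomp V v k) w)"

definition ract :: "('v::ab_group_add, 'z) voa_data_scheme \<Rightarrow>
    ('v, 'w::ab_group_add, 'y) weak_module_data_scheme \<Rightarrow> nat \<Rightarrow> 'w \<Rightarrow> 'v \<Rightarrow> 'w" where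
  "ract V W n w v = Sum_any (\<lambda>k. ract_wt W n k w (hcomp V v k))"

definition O'_gens :: "('v::ab_group_add, 'z) voa_data_scheme \<Rightarrow>
    ('v, 'w::ab_group_add, 'y) weak_module_data_scheme \<Rightarrow> nat \<Rightarrow> 'w set" where
  "O'_gens V W n =
     {res_Y W (fls_X powi (- 2 * int n - 2) * (1 + fls_X) powi (k + int n)) v w |
        k v w. v \<in> wt_space V k}"

definition O' :: "('v::ab_group_add, 'z) voa_data_scheme \<Rightarrow>
    ('v, 'w::ab_group_add, 'y) weak_module_data_scheme \<Rightarrow> nat \<Rightarrow> 'w set" where
  "O' V W n = Modules.module.span (smul W) (O'_gens V W n)"

definition O_n :: "('v::ab_group_add, 'z) voa_data_scheme \<Rightarrow> nat \<Rightarrow> 'v set" where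
  "O_n V n = Modules.module.span (smul V)
     ({Lop V (-1) v + Lop V 0 v | v. True} \<union> O'_gens V V n)"

section \<open>Algebras, bimodules and quotients\<close>

text \<open>The algebra class of the library is restricted to commutative algebras.\<close>

locale assoc_algebra = module K A + ring A for K (structure) and A (structure) +
  assumes smult_mult_left: "\<lbrakk>c \<in> carrier K; a \<in> carrier A; b \<in> carrier A\<rbrakk> \<Longrightarrow>
      (c \<odot>\<^bsub>A\<^esub> a) \<otimes>\<^bsub>A\<^esub> b = c \<odot>\<^bsub>A\<^esub> (a \<otimes>\<^bsub>A\<^esub> b)"
    and smult_mult_right: "\<lbrakk>c \<in> carrier K; a \<in> carrier A; b \<in> carrier A\<rbrakk> \<Longrightarrow>
      a \<otimes>\<^bsub>A\<^esub> (c \<odot>\<^bsub>A\<^esub> b) = c \<odot>\<^bsub>A\<^esub> (a \<otimes>\<^bsub>A\<^esub> b)"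

locale bimodule = A: assoc_algebra K A + M: module K M
  for K :: "('k, 'x) ring_scheme" and A :: "('k, 'a, 'y) module_scheme"
    and M :: "('k, 'm, 'z) module_scheme" +
  fixes la :: "'a \<Rightarrow> 'm \<Rightarrow> 'm" (infixr \<open>\<rhd>\<close> 72)
    and ra :: "'m \<Rightarrow> 'a \<Rightarrow> 'm" (infixl \<open>\<lhd>\<lhd>\<close> 72)
  assumes la_closed: "\<lbrakk>a \<in> carrier A; x \<in> carrier M\<rbrakk> \<Longrightarrow> a \<rhd> x \<in> carrier M"
    and ra_closed: "\<lbrakk>a \<in> carrier A; x \<in> carrier M\<rbrakk> \<Longrightarrow> x \<lhd>\<lhd> a \<in> carrier M"
    and la_add_left: "\<lbrakk>a \<in> carrier A; b \<in> carrier A; x \<in> carrier M\<rbrakk> \<Longrightarrow>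
      (a \<oplus>\<^bsub>A\<^esub> b) \<rhd> x = (a \<rhd> x) \<oplus>\<^bsub>M\<^esub> (b \<rhd> x)"
    and la_add_right: "\<lbrakk>a \<in> carrier A; x \<in> carrier M; y \<in> carrier M\<rbrakk> \<Longrightarrow>
      a \<rhd> (x \<oplus>\<^bsub>M\<^esub> y) = (a \<rhd> x) \<oplus>\<^bsub>M\<^esub> (a \<rhd> y)"
    and ra_add_left: "\<lbrakk>a \<in> carrier A; x \<in> carrier M; y \<in> carrier M\<rbrakk> \<Longrightarrow>
      (x \<oplus>\<^bsub>M\<^esub> y) \<lhd>\<lhd> a = (x \<lhd>\<lhd> a) \<oplus>\<^bsub>M\<^esub> (y \<lhd>\<lhd> a)"
    and ra_add_right: "\<lbrakk>a \<in> carrier A; b \<in> carrier A; x \<in> carrier M\<rbrakk> \<Longrightarrow>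
      x \<lhd>\<lhd> (a \<oplus>\<^bsub>A\<^esub> b) = (x \<lhd>\<lhd> a) \<oplus>\<^bsub>M\<^esub> (x \<lhd>\<lhd> b)"
    and la_smult_left: "\<lbrakk>c \<in> carrier K; a \<in> carrier A; x \<in> carrier M\<rbrakk> \<Longrightarrow>
      (c \<odot>\<^bsub>A\<^esub> a) \<rhd> x = c \<odot>\<^bsub>M\<^esub> (a \<rhd> x)"
    and la_smult_right: "\<lbrakk>c \<in> carrier K; a \<in> carrier A; x \<in> carrier M\<rbrakk> \<Longrightarrow>
      a \<rhd> (c \<odot>\<^bsub>M\<^esub> x) = c \<odot>\<^bsub>M\<^esub> (a \<rhd> x)"
    and ra_smult_left: "\<lbrakk>c \<in> carrier K; a \<in> carrier A; x \<in> carrier M\<rbrakk> \<Longrightarrow>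
      (c \<odot>\<^bsub>M\<^esub> x) \<lhd>\<lhd> a = c \<odot>\<^bsub>M\<^esub> (x \<lhd>\<lhd> a)"
    and ra_smult_right: "\<lbrakk>c \<in> carrier K; a \<in> carrier A; x \<in> carrier M\<rbrakk> \<Longrightarrow>
      x \<lhd>\<lhd> (c \<odot>\<^bsub>A\<^esub> a) = c \<odot>\<^bsub>M\<^esub> (x \<lhd>\<lhd> a)"
    and la_one: "x \<in> carrier M \<Longrightarrow> \<one>\<^bsub>A\<^esub> \<rhd> x = x"
    and ra_one: "x \<in> carrier M \<Longrightarrow> x \<lhd>\<lhd> \<one>\<^bsub>A\<^esub> = x"
    and la_assoc: "\<lbrakk>a \<in> carrier A; b \<in> carrier A; x \<in> carrier M\<rbrakk> \<Longrightarrow>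
      (a \<otimes>\<^bsub>A\<^esub> b) \<rhd> x = a \<rhd> (b \<rhd> x)"
    and ra_assoc: "\<lbrakk>a \<in> carrier A; b \<in> carrier A; x \<in> carrier M\<rbrakk> \<Longrightarrow>
      x \<lhd>\<lhd> (a \<otimes>\<^bsub>A\<^esub> b) = (x \<lhd>\<lhd> a) \<lhd>\<lhd> b"
    and la_ra_assoc: "\<lbrakk>a \<in> carrier A; b \<in> carrier A; x \<in> carrier M\<rbrakk> \<Longrightarrow>
      (a \<rhd> x) \<lhd>\<lhd> b = a \<rhd> (x \<lhd>\<lhd> b)"

text \<open>
  Operations induced on cosets. As with \<^const>\<open>rcoset_mult\<close>, the union is a single coset precisely
  when the class of the result does not depend on the representatives.
\<close>

definition induced1 :: "'b::ab_group_add set \<Rightarrow> ('a \<Rightarrow> 'b) \<Rightarrow> 'a set \<Rightarrow> 'b set" where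
  "induced1 S f C = (\<Union>x\<in>C. f x +o S)"

definition induced2 ::
  "'c::ab_group_add set \<Rightarrow> ('a \<Rightarrow> 'b \<Rightarrow> 'c) \<Rightarrow> 'a set \<Rightarrow> 'b set \<Rightarrow> 'c set" where
  "induced2 S f C D = (\<Union>x\<in>C. \<Union>y\<in>D. f x y +o S)"

text \<open>The multiplicative fields of the record are not used for modules.\<close>

definition quotient_space ::
  "(complex \<Rightarrow> 'w \<Rightarrow> 'w) \<Rightarrow> 'w::ab_group_add set \<Rightarrow> (complex, 'w set) module" where
  "quotient_space s S = \<lparr>carrier = range (\<lambda>w. w +o S), monoid.mult = undefined, one = undefined,
     zero = 0 +o S, add = induced2 S (+), module.smult = (\<lambda>c. induced1 S (s c))\<rparr>"

definition A_n :: "('v::ab_group_add, 'z) voa_data_scheme \<Rightarrow> nat \<Rightarrow> (complex, 'v set) module" where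
  "A_n V n = (quotient_space (smul V) (O_n V n))
     \<lparr>monoid.mult := induced2 (O_n V n) (lact V V n), one := vac V +o O_n V n\<rparr>"

definition A' :: "('v::ab_group_add, 'z) voa_data_scheme \<Rightarrow>
    ('v, 'w::ab_group_add, 'y) weak_module_data_scheme \<Rightarrow> nat \<Rightarrow> (complex, 'w set) module" where
  "A' V W n = quotient_space (smul W) (O' V W n)"

section \<open>The linear extensions agree with the formulas on homogeneous vectors\<close>

lemma (in weak_module) res_Y_0: "res_Y W f 0 w = 0"
proof -
  interpret v: vector_space "smul V" by (rule vector_space_V)
  interpret w: vector_space "smul W" by (rule vector_space_W)
  have "mode W 0 k w = 0" for k
    by (rule Vector_Spaces.linear.axioms(3)[OF linear_state, THEN module_hom.zero])
  then show ?thesis by (simp add: res_Y_def)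
qed

lemma (in voa) hcomp_homogeneous:
  assumes "v \<in> wt_space V k"
  shows "hcomp V v = (\<lambda>j. if j = k then v else 0)"
proof -
  interpret v: vector_space "smul V" by (rule vector_space_V)
  have zero: "0 \<in> wt_space V j" for j
    using Vector_Spaces.linear.axioms(3)[OF linear_mode, THEN module_hom.zero]
    by (simp add: wt_space_def Lop_def)
  let ?f = "\<lambda>j. if j = k then v else 0"
  have "finite {j. ?f j \<noteq> 0}"
    by (rule finite_subset[of _ "{k}"]) auto
  moreover have "Sum_any ?f = v"
    by (rule Sum_any.delta)
  ultimately have "is_decomp V v ?f"
    using assms zero by (simp add: is_decomp_def)
  then show ?thesis
    unfolding hcomp_def by (rule the1_equality[OF direct_sum])
qed

lemma act_homogeneous:
  assumes "voa V" "weak_module V W" "v \<in> wt_space V k"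
  shows "lact V W n v w = lact_wt W n k v w" "ract V W n w v = ract_wt W n k w v"
proof -
  interpret w: vector_space "smul W" by (rule weak_module.vector_space_W[OF assms(2)])
  have l: "lact_wt W n j 0 w = 0" and r: "ract_wt W n j w 0 = 0" for j
    by (simp_all add: lact_wt_def ract_wt_def weak_module.res_Y_0[OF assms(2)])
  have "lact V W n v w = Sum_any (\<lambda>j. if j = k then lact_wt W n k v w else 0)"
    unfolding lact_def voa.hcomp_homogeneous[OF assms(1,3)]
    by (rule arg_cong[where f = Sum_any]) (simp add: l fun_eq_iff)
  then show "lact V W n v w = lact_wt W n k v w"
    by (simp only: Sum_any.delta)
  have "ract V W n w v = Sum_any (\<lambda>j. if j = k then ract_wt W n k w v else 0)"
    unfolding ract_def voa.hcomp_homogeneous[OF assms(1,3)]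
    by (rule arg_cong[where f = Sum_any]) (simp add: r fun_eq_iff)
  then show "ract V W n w v = ract_wt W n k w v"
    by (simp only: Sum_any.delta)
qed

end

theory Submission
  imports Defs
begin

text \<open>
  For a Laurent series \<open>g\<close> and a homogeneous \<open>v\<close> let \<open>wres V W g v w\<close> be the residue of
  \<open>g(x) (1+x)^(wt v) Y(v,x) w\<close>. The left action is \<open>wres\<close> with the kernel \<open>lkernel n\<close>, the right
  action is \<open>wres\<close> with the kernel \<open>rkernel n\<close>, and \<open>O'\<close> is spanned by the values of \<open>wres\<close> at the
  kernels \<open>x^a (1+x)^n\<close> with \<open>a \<le> -2n-2\<close> (\<open>wres_xmon_O'\<close>). Up to such kernels, \<open>lkernel n\<close> is \<open>(1+x)^n\<close>
  times the expansion of \<open>(1+x)^(-n-1)\<close> at infinity, while \<open>lkernel n - rkernel n\<close> is the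
  expansion of \<open>(1+x)^(-1)\<close> at \<open>0\<close> (\<open>lkernel_minus_rkernel\<close>). So, heuristically, the left action
  integrates \<open>(1+x)^(wt v - 1) Y(v,x)\<close> around infinity, the operator \<open>wres\<close> with kernel
  \<open>(1+x)^(-1)\<close>, called the commutator operator of \<open>v\<close> below, integrates it around \<open>0\<close>, and the right
  action around \<open>-1\<close>. The bimodule axioms express deformations of these contours, that is,
  instances of the Jacobi identity.

  The weight factor makes the substitution \<open>x\<^sub>1 = x\<^sub>2 + (1+x\<^sub>2) y\<close> work: both
  \<open>x\<^sub>1 - x\<^sub>2 = (1+x\<^sub>2) y\<close> and \<open>1 + x\<^sub>1 = (1+x\<^sub>2)(1+y)\<close> factor, and the Jacobi identity becomes a
  formula for \<open>wres\<close> at a vector that is itself a value of \<open>wres\<close> (\<open>wres_product\<close>). Its first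
  consequence is that commutator operators act as derivations (\<open>comm_derivation\<close>). In the
  product formula for \<open>lkernel n\<close> the half in which \<open>u\<close> acts last is composition with the left
  action of \<open>u\<close>, modulo \<open>O'\<close>, for every outer kernel, because \<open>(x\<^sub>1-x\<^sub>2) + (1+x\<^sub>2) = 1+x\<^sub>1\<close> lets one
  rewrite the expansion of \<open>(1+x\<^sub>1)^(-n-1)\<close> at infinity (\<open>lkernel_reexpansion\<close>, \<open>lact_product\<close>). The
  other half lies in \<open>O'\<close> if the outer kernel is \<open>x^a (1+x)^n\<close> with \<open>a \<le> -n-1\<close>; this gives
  associativity of the left action and the stability of \<open>O'\<close> (\<open>lact_xmon_assoc\<close>). If the outer
  kernel is \<open>(1+x)^(-1)\<close>, the other half is the right action of \<open>v\<close> after the commutator operator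
  of \<open>u\<close> (\<open>comm_lact\<close>). Left and right actions commute by the commutator formula
  (\<open>left_right_commute\<close>), and the associativity of the right action follows from these facts,
  since the right action is the left action minus the commutator operator (\<open>ract_assoc\<close>).

  The generators \<open>(L(-1)+L(0))v\<close> of \<open>O\<^sub>n(V)\<close> are harmless for two reasons. Replacing \<open>v\<close> by
  \<open>(L(-1)+L(0))v\<close> replaces a kernel \<open>g\<close> by minus the derivative of \<open>(1+x) g\<close> (\<open>wres_Lsum\<close>), and for
  both action kernels that derivative telescopes to a multiple of \<open>x^(-2n-2) (1+x)^n\<close>. Moreover
  \<open>L(-1)+L(0)\<close> is the commutator operator of the conformal vector (\<open>Lsum_eq\<close>), hence a derivation.
  Thus \<open>O\<^sub>n(V)\<close> is a two-sided ideal, and the associative algebra \<open>A\<^sub>n(V)\<close> is obtained from the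
  same lemmas with \<open>W = V\<close>; that the vacuum is a right unit uses that \<open>lkernel n\<close> is \<open>x^(-1)\<close> plus a
  derivative (\<open>lact_vac_right\<close>).
\<close>

section \<open>Laurent monomials in x and 1 + x\<close>

(* Powers of the variable are kept as powers instead of being turned into shifts. *)
declare fls_X_power_int [simp del]

definition xmon :: "int \<Rightarrow> int \<Rightarrow> complex fls" where
  "xmon a c = fls_X powi a * (1 + fls_X) powi c"

lemma one_plus_fls_X_nonzero [simp]: "1 + fls_X \<noteq> (0 :: complex fls)"
proof
  assume "1 + fls_X = (0 :: complex fls)"
  then have "fls_nth (1 + fls_X :: complex fls) 0 = 0" by simp
  then show False by simp
qed

lemma xmon_mult: "xmon a c * xmon a' c' = xmon (a + a') (c + c')"
  by (simp add: xmon_def power_int_add)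

lemma xmon_0_0 [simp]: "xmon 0 0 = 1"
  by (simp add: xmon_def)

lemma xmon_split: "xmon a (c + 1) = xmon a c + xmon (a + 1) c"
proof -
  have "(1 + fls_X :: complex fls) powi (c + 1) = (1 + fls_X) powi c * (1 + fls_X)"
    "(fls_X :: complex fls) powi (a + 1) = fls_X powi a * fls_X"
    by (rule power_int_add_1; simp)+
  then show ?thesis
    by (simp only: xmon_def) (simp only: algebra_simps mult_1)
qed

lemma xmon_nth: "fls_nth (xmon a c) k = (if k < a then 0 else of_int c gchoose nat (k - a))"
  by (simp add: xmon_def fls_X_power_int fls_X_intpow_times_conv_shift(1) one_plus_fls_X_powi_eq)

lemma xmon_monom_nth: "fls_nth (xmon a 0) k = (if k = a then 1 else 0)"
  by (auto simp: xmon_nth gbinomial_0_left)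

lemma xmon_0_nat: "xmon 0 (int m) = (1 + fls_X) ^ m"
  by (simp add: xmon_def)

lemma xmon_nat_0: "xmon (int m) 0 = fls_X ^ m"
  by (simp add: xmon_def)

lemma xmon_expand: "xmon p (c + int N) = (\<Sum>s\<le>N. fls_const (of_nat (N choose s)) * xmon (p + int s) c)"
proof -
  have "xmon p (c + int N) = xmon p c * (fls_X + 1) ^ N"
    using xmon_mult[of p c 0 "int N"] by (simp add: xmon_0_nat add.commute)
  also have "\<dots> = (\<Sum>s\<le>N. xmon p c * (of_nat (N choose s) * fls_X ^ s))"
    unfolding binomial_ring by (simp add: sum_distrib_left)
  also have "\<dots> = (\<Sum>s\<le>N. fls_const (of_nat (N choose s)) * xmon (p + int s) c)"
    using xmon_mult[of p c "int _" 0] by (intro sum.cong)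
        (simp_all add: xmon_nat_0 fls_of_nat mult.left_commute)
  finally show ?thesis .
qed

lemma fls_deriv_powi: "fls_deriv (f powi c) = of_int c * f powi (c - 1) * fls_deriv f"
  if "f \<noteq> 0" for f :: "complex fls"
proof (induction c rule: int_induct[of _ 0])
  case base
  show ?case by simp
next
  case (step1 i)
  have "fls_deriv (f powi (i + 1)) = fls_deriv (f powi i * f)"
    using that by (simp add: power_int_add)
  also have "\<dots> = of_int i * (f powi (i - 1) * f) * fls_deriv f + f powi i * fls_deriv f"
    by (simp add: step1 algebra_simps)
  also have "f powi (i - 1) * f = f powi i"
    using that by (simp add: power_int_minus_mult)
  finally show ?case by (simp add: algebra_simps)
next
  case (step2 i)
  have "fls_deriv (f powi (i - 1)) * f = fls_deriv (f powi i) - f powi (i - 1) * fls_deriv f"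
    using that fls_deriv_mult[of "f powi (i - 1)" f] by (simp add: power_int_minus_mult)
  also have "\<dots> = of_int (i - 1) * f powi (i - 2) * f * fls_deriv f"
    using that power_int_minus_mult[of f "i - 1"] by (simp add: step2 algebra_simps)
  finally have "fls_deriv (f powi (i - 1)) * f = (of_int (i - 1) * f powi (i - 2) * fls_deriv f) * f"
    by (simp only: ac_simps)
  with that show ?case by simp
qed

lemma fls_deriv_xmon:
  "fls_deriv (xmon a c) = fls_const (of_int a) * xmon (a - 1) c + fls_const (of_int c) * xmon a (c - 1)"
proof -
  have "fls_deriv ((1 + fls_X :: complex fls) powi c) = of_int c * (1 + fls_X) powi (c - 1)"
    using fls_deriv_powi[OF one_plus_fls_X_nonzero] by simp
  moreover have "fls_deriv ((fls_X :: complex fls) powi a) = of_int a * fls_X powi (a - 1)"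
    using fls_deriv_powi[of fls_X] by simp
  ultimately show ?thesis
    by (simp only: xmon_def fls_deriv_mult fls_of_int) (simp only: ac_simps)
qed

lemma higher_deriv_xmon_0:
  "(fls_deriv ^^ i) (xmon 0 c) = fls_const (fact i * (of_int c gchoose i)) * xmon 0 (c - int i)"
proof (induction i)
  case (Suc i)
  have "fls_deriv (fls_const (fact i * (of_int c gchoose i)) * xmon 0 (c - int i))
      = fls_const (fact i * (of_int c gchoose i) * of_int (c - int i)) * xmon 0 (c - int i - 1)"
    by (simp add: fls_deriv_xmon del: of_int_diff)
  also have "fact i * (of_int c gchoose i) * of_int (c - int i)
      = (fact (Suc i) * (of_int c gchoose Suc i) :: complex)"
    using gbinomial_mult_1[of "of_int c :: complex" i] by (simp add: algebra_simps)
  also have "c - int i - 1 = c - int (Suc i)" by simp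
  finally show ?case using Suc by simp
qed simp

lemma higher_deriv_xmon_monom:
  "(fls_deriv ^^ i) (xmon m 0) = fls_const (fact i * (of_int m gchoose i)) * xmon (m - int i) 0"
proof (induction i)
  case (Suc i)
  have "fls_deriv (fls_const (fact i * (of_int m gchoose i)) * xmon (m - int i) 0)
      = fls_const (fact i * (of_int m gchoose i) * of_int (m - int i)) * xmon (m - int i - 1) 0"
    by (simp add: fls_deriv_xmon del: of_int_diff)
  also have "fact i * (of_int m gchoose i) * of_int (m - int i)
      = (fact (Suc i) * (of_int m gchoose Suc i) :: complex)"
    using gbinomial_mult_1[of "of_int m :: complex" i] by (simp add: algebra_simps)
  also have "m - int i - 1 = m - int (Suc i)" by simp
  finally show ?case using Suc by simp
qed simp

lemma higher_deriv_add: "(fls_deriv ^^ i) (f + g) = (fls_deriv ^^ i) f + (fls_deriv ^^ i)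
    (g :: complex fls)"
  by (induction i) simp_all

lemma higher_deriv_const: "(fls_deriv ^^ i) (fls_const c * f) = fls_const c * (fls_deriv ^^ i)
    (f :: complex fls)"
  by (induction i) simp_all

text \<open>
  By the product rule the \<open>i\<close>-th derivative of \<open>x^p (1+x)^c\<close> is a linear combination of the
  monomials listed in the first assumption. Membership in a closed set expresses this without
  naming the coefficients.
\<close>

lemma higher_deriv_xmon_closed:
  assumes "\<And>s. s \<le> i \<Longrightarrow> xmon (p - int s) (c - int i + int s) \<in> S"
    and "\<And>f g. f \<in> S \<Longrightarrow> g \<in> S \<Longrightarrow> f + g \<in> S" and "\<And>d f. f \<in> S \<Longrightarrow> fls_const d * f \<in> S"
  shows "(fls_deriv ^^ i) (xmon p c) \<in> S"
  using assms
proof (induction i arbitrary: S)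
  case 0
  show ?case using "0.prems"(1)[of 0] by simp
next
  case (Suc i)
  have "(fls_deriv ^^ i) (xmon p c) \<in> {f. fls_deriv f \<in> S}"
  proof (rule Suc.IH)
    fix s assume s: "s \<le> i"
    have "xmon (p - int s - 1) (c - int i + int s) \<in> S"
      using Suc.prems(1)[of "Suc s"] s by (simp add: algebra_simps)
    moreover have "xmon (p - int s) (c - int i + int s - 1) \<in> S"
      using Suc.prems(1)[of s] s by (simp add: algebra_simps)
    ultimately show "xmon (p - int s) (c - int i + int s) \<in> {f. fls_deriv f \<in> S}"
      by (simp only: mem_Collect_eq fls_deriv_xmon Suc.prems(2,3))
  qed (simp_all add: Suc.prems(2,3))
  then show ?case by simp
qed

lemma fls_deriv_eq_0_D:
  assumes "fls_deriv f = 0"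
  shows "f = fls_const (fls_nth f 0 :: complex)"
proof (rule fls_eqI)
  fix k
  have "of_int k * fls_nth f k = 0"
    using arg_cong[OF assms, of "\<lambda>f. fls_nth f (k - 1)"] by simp
  then show "fls_nth f k = fls_nth (fls_const (fls_nth f 0)) k" by auto
qed

lemma fls_const_of_nat_mult: "fls_const (of_nat k * c) = of_nat k * (fls_const c :: complex fls)"
  by (simp add: fls_of_nat flip: fls_const_mult_const)

lemma gchoose_of_nat_eq_0: "(of_nat k :: complex) gchoose l = 0" if "k < l"
  using that by (simp flip: binomial_gbinomial)

lemma one_plus_fps_X_power_nth:
  "fps_nth ((1 + fps_X) ^ n :: complex fls fps) i = fls_const (of_nat (n choose i))"
proof -
  have "(1 + fps_X) ^ n = (fps_binomial (of_nat n) :: complex fls fps)"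
    by (simp add: fps_binomial_of_nat)
  then show ?thesis by (simp flip: binomial_gbinomial fls_of_nat)
qed

definition ord_ge :: "int \<Rightarrow> complex fls \<Rightarrow> bool" where
  "ord_ge M f \<longleftrightarrow> (\<forall>k<M. fls_nth f k = 0)"

lemma ord_ge_iff: "ord_ge M f \<longleftrightarrow> f = 0 \<or> M \<le> fls_subdegree f"
  unfolding ord_ge_def
  by (metis fls_subdegree_geI fls_eq0_below_subdegree fls_zero_nth order_less_le_trans)

lemma ord_ge_exists: "\<exists>M. ord_ge M f"
  using ord_ge_iff by blast

lemma ord_ge_mult: "ord_ge M f \<Longrightarrow> ord_ge N g \<Longrightarrow> ord_ge (M + N) (f * g)"
  by (cases "f = 0 \<or> g = 0") (auto simp: ord_ge_iff)

lemma ord_ge_deriv: "ord_ge M f \<Longrightarrow> ord_ge (M - int i) ((fls_deriv ^^ i) f)"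
  by (induction i) (auto simp: ord_ge_def)

lemma ord_ge_mono: "ord_ge M f \<Longrightarrow> N \<le> M \<Longrightarrow> ord_ge N f"
  by (auto simp: ord_ge_def)

section \<open>The kernels of the two actions\<close>

text \<open>
  These are the coefficients of \<open>(1 + 1/x)^(-n-1)\<close> in powers of \<open>1/x\<close>.
\<close>

definition act_coeff :: "nat \<Rightarrow> nat \<Rightarrow> complex" where
  "act_coeff n m = (- of_nat n - 1) gchoose m"

lemma act_coeff_0 [simp]: "act_coeff n 0 = 1"
  by (simp add: act_coeff_def)

text \<open>
  This recursion makes the derivatives of the kernels below telescope.
\<close>

lemma act_coeff_Suc: "of_nat (Suc m) * act_coeff n (Suc m) = - of_nat (n + m + 1) * act_coeff n m"
proof -
  have "of_nat (Suc m) * act_coeff n (Suc m) = (- of_nat n - 1) * act_coeff n m - of_nat m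
      * act_coeff n m"
    using gbinomial_mult_1[of "- of_nat n - 1 :: complex" m] unfolding act_coeff_def
    by (metis add_diff_cancel_left')
  also have "\<dots> = - of_nat (n + m + 1) * act_coeff n m" by (simp add: algebra_simps)
  finally show ?thesis .
qed

lemma act_coeff_Suc_sign: "of_nat (Suc m) * (act_coeff n (Suc m) * (-1) ^ (n + Suc m))
   = of_nat (n + m + 1) * (act_coeff n m * (-1) ^ (n + m))"
proof -
  have "of_nat (Suc m) * (act_coeff n (Suc m) * (-1) ^ (n + Suc m))
     = (of_nat (Suc m) * act_coeff n (Suc m)) * - ((-1) ^ (n + m))"
    by simp
  then show ?thesis unfolding act_coeff_Suc
      by (simp only: mult_minus_left mult_minus_right minus_minus mult.assoc)
qed

text \<open>
  The expansion of \<open>(1+x)^(-n-1)\<close> at infinity, cut off before \<open>x^(-2n-2)\<close>, multiplied by \<open>(1+x)^n\<close>.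
\<close>

definition lkernel :: "nat \<Rightarrow> complex fls" where
  "lkernel n = (\<Sum>m=0..n. fls_const (act_coeff n m) * xmon (- int n - int m - 1) (int n))"

definition rkernel :: "nat \<Rightarrow> complex fls" where
  "rkernel n = (\<Sum>m=0..n. fls_const (act_coeff n m * (-1) ^ (n - m)) * xmon (- int n - int m - 1)
      (int m - 1))"

text \<open>
  The derivative annihilates \<open>(1+x)^(n+1)\<close> times the full expansion of \<open>(1+x)^(-n-1)\<close>, which is \<open>1\<close>;
  what is left comes from the place where the expansion is cut off.
\<close>

lemma deriv_lkernel:
  "fls_deriv (xmon 0 1 * lkernel n) = fls_const (of_nat (n + 1) * act_coeff n (n + 1))
      * xmon (- 2 * int n - 2) (int n)"
proof -
  define T where "T m = fls_const (of_nat m * act_coeff n m) * xmon (- int n - int m - 1) (int n)" for m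
  have "fls_deriv (xmon 0 1 * lkernel n) = (\<Sum>m=0..n. fls_const (act_coeff n m) *
     fls_deriv (xmon (- int n - int m - 1) (int n + 1)))"
    by (simp only: lkernel_def sum_distrib_left fls_deriv_sum mult.left_commute[of "xmon 0 1"] xmon_mult
       fls_deriv_mult_const_left) (simp add: add.commute)
  also have "\<dots> = (\<Sum>m=0..n. T (Suc m) - T m)"
  proof (rule sum.cong)
    fix m
    have eq: "fls_const (of_nat (Suc m) * act_coeff n (Suc m)) =
        fls_const (- of_nat (n + m + 1) * act_coeff n m)"
      by (simp only: act_coeff_Suc)
    define p where "p = - int n - int m - 2"
    have p: "- int n - int m - 1 = p + 1" "- int n - int (Suc m) - 1 = p" "p + 1 - 1 = p"
      "- int n - int m - 1 - 1 = p"
      by (simp_all add: p_def)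
    have q: "of_int (p + 1) = (- of_nat (n + m + 1) :: complex)" by (simp add: p_def)
    show "fls_const (act_coeff n m) * fls_deriv (xmon (- int n - int m - 1) (int n + 1)) = T (Suc m)
        - T m"
      unfolding T_def eq p fls_deriv_xmon xmon_split[of p "int n"] q
      by (simp add: algebra_simps flip: fls_const_mult_const fls_plus_const fls_minus_const)
  qed simp
  also have "\<dots> = T (Suc n) - T 0"
    using sum_Suc_diff[of 0 "Suc n" T] by (simp
        add: atLeast0AtMost lessThan_Suc_atMost[symmetric] sum_lessThan_telescope)
  also have "\<dots> = fls_const (of_nat (n + 1) * act_coeff n (n + 1)) * xmon (- int n - int (Suc n) - 1)
      (int n)"
    by (simp add: T_def)
  also have "- int n - int (Suc n) - 1 = - 2 * int n - 2" by simp
  finally show ?thesis .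
qed

text \<open>
  Writing the sign with \<open>n + m\<close> removes the truncated subtraction.
\<close>

lemma rkernel_alt:
  "rkernel n = (\<Sum>m=0..n. fls_const (act_coeff n m * (-1) ^ (n + m)) * xmon (- int n - int m - 1)
      (int m - 1))"
  unfolding rkernel_def
  by (intro sum.cong refl arg_cong2[where f = "(*)"] arg_cong[where f = fls_const])
    (auto simp: minus_one_power_iff)

lemma deriv_rkernel:
  "fls_deriv (xmon 0 1 * rkernel n) = fls_const (of_nat (n + 1) * act_coeff n (n + 1))
      * xmon (- 2 * int n - 2) (int n)"
proof -
  define T where "T m = fls_const (of_nat m * (act_coeff n m * (-1) ^ (n + m)))
      * xmon (- int n - int m - 1) (int m - 1)" for m
  have "fls_deriv (xmon 0 1 * rkernel n) = (\<Sum>m=0..n. fls_const (act_coeff n m * (-1) ^ (n + m)) *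
     fls_deriv (xmon (- int n - int m - 1) (int m)))"
    by (simp only: rkernel_alt sum_distrib_left fls_deriv_sum mult.left_commute[of "xmon 0 1"] xmon_mult
       fls_deriv_mult_const_left) simp
  also have "\<dots> = (\<Sum>m=0..n. T m - T (Suc m))"
  proof (rule sum.cong)
    fix m
    define p where "p = - int n - int m - 2"
    define c where "c = act_coeff n m * (-1) ^ (n + m)"
    have p: "- int n - int m - 1 = p + 1" "- int n - int (Suc m) - 1 = p" "p + 1 - 1 = p"
      "- int n - int m - 1 - 1 = p"
      by (simp_all add: p_def)
    have q: "of_int (p + 1) = (- of_nat (n + m + 1) :: complex)" by (simp add: p_def)
    have s: "int (Suc m) - 1 = int m" by simp
    show "fls_const (act_coeff n m * (-1) ^ (n + m)) * fls_deriv
        (xmon (- int n - int m - 1) (int m)) = T m - T (Suc m)"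
      unfolding T_def act_coeff_Suc_sign p fls_deriv_xmon q s unfolding c_def[symmetric]
      by (simp add: algebra_simps flip: fls_const_mult_const fls_plus_const fls_minus_const)
  qed simp
  also have "\<dots> = T 0 - T (Suc n)"
    by (simp only: atLeast0AtMost flip: lessThan_Suc_atMost) (rule sum_lessThan_telescope')
  also have "\<dots> = fls_const (of_nat (n + 1) * act_coeff n (n + 1)) * xmon (- int n - int (Suc n) - 1)
      (int n)"
  proof -
    have "(-1 :: complex) ^ (n + Suc n) = -1" by (simp add: minus_one_power_iff)
    moreover have "int (Suc n) - 1 = int n" by simp
    ultimately show ?thesis by (simp only: T_def) (simp del: of_nat_Suc)
  qed
  also have "- int n - int (Suc n) - 1 = - 2 * int n - 2" by simp
  finally show ?thesis .
qed

text \<open>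
  Multiplied by \<open>1 + x\<close>, the two kernels have the same derivative. So they differ by a constant,
  which is found at \<open>x^0\<close>: there the right kernel contributes nothing, as all its powers of \<open>x\<close>
  are negative.
\<close>

lemma lkernel_minus_rkernel: "lkernel n - rkernel n = xmon 0 (-1)"
proof -
  define d where "d = xmon 0 1 * lkernel n - xmon 0 1 * rkernel n"
  have "fls_deriv d = 0" by (simp add: d_def deriv_lkernel deriv_rkernel del: fls_deriv_mult)
  then have "d = fls_const (fls_nth d 0)" by (rule fls_deriv_eq_0_D)
  also have "fls_nth d 0 = 1"
  proof -
    have "fls_nth (xmon 0 1 * lkernel n) 0
      = (\<Sum>m=0..n. act_coeff n m * (of_nat (n + 1) gchoose (n + m + 1)))"
    proof -
      have "fls_nth (xmon 0 1 * lkernel n) 0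
         = (\<Sum>m=0..n. fls_nth (fls_const (act_coeff n m) * xmon (- int n - int m - 1) (1 + int n)) 0)"
        by (simp only: lkernel_def sum_distrib_left mult.left_commute[of "xmon 0 1"] xmon_mult
            fls_nth_sum) simp
      also have "\<dots> = (\<Sum>m=0..n. act_coeff n m * (of_nat (n + 1) gchoose (n + m + 1)))"
        by (intro sum.cong refl) (simp add: fls_mult_const_nth xmon_nth nat_diff_distrib algebra_simps nat_add_distrib)
      finally show ?thesis .
    qed
    also have "\<dots> = (\<Sum>m=0..n. if m = 0 then 1 else 0)"
    proof (rule sum.cong)
      fix m
      have "(of_nat (n + 1) :: complex) gchoose (n + 1) = 1"
        by (simp flip: binomial_gbinomial del: of_nat_add of_nat_Suc)
      then show "act_coeff n m * (of_nat (n + 1) gchoose (n + m + 1)) = (if m = 0 then 1 else 0)"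
        using gchoose_of_nat_eq_0[of "n + 1" "n + m + 1"] by auto
    qed simp
    finally have P: "fls_nth (xmon 0 1 * lkernel n) 0 = 1" by simp
    have "fls_nth (xmon 0 1 * rkernel n) 0
         = (\<Sum>m=0..n. fls_nth (fls_const (act_coeff n m * (-1) ^ (n + m))
            * xmon (- int n - int m - 1) (int m)) 0)"
      by (simp only: rkernel_alt sum_distrib_left mult.left_commute[of "xmon 0 1"] xmon_mult
          fls_nth_sum) simp
    also have "\<dots> = 0"
      using gchoose_of_nat_eq_0
      by (intro sum.neutral ballI) (simp
          add: fls_mult_const_nth xmon_nth nat_diff_distrib algebra_simps nat_add_distrib)
    finally show ?thesis using P by (simp add: d_def)
  qed
  finally have "xmon 0 (-1) * d = xmon 0 (-1)" by simp
  moreover have "xmon 0 (-1) * d = lkernel n - rkernel n"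
    by (simp add: d_def right_diff_distrib xmon_mult flip: mult.assoc)
  ultimately show ?thesis by simp
qed

lemma lkernel_residue: "fls_nth (lkernel n) (-1) = 1"
proof -
  have "fls_nth (lkernel n) (-1) = (\<Sum>m=0..n. act_coeff n m * (of_nat n gchoose (n + m)))"
    unfolding lkernel_def fls_nth_sum
    by (intro sum.cong refl) (simp add: xmon_nth nat_diff_distrib algebra_simps nat_add_distrib)
  also have "\<dots> = (\<Sum>m=0..n. if m = 0 then 1 else 0)"
  proof (rule sum.cong)
    fix m
    have "(of_nat n :: complex) gchoose n = 1"
      by (simp flip: binomial_gbinomial)
    then show "act_coeff n m * (of_nat n gchoose (n + m)) = (if m = 0 then 1 else 0)"
      using gchoose_of_nat_eq_0[of n "n + m"] by auto
  qed simp
  finally show ?thesis by simp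
qed

text \<open>
  Since \<open>(x\<^sub>1-x\<^sub>2) + (1+x\<^sub>2) = 1+x\<^sub>1\<close>, the sums over \<open>m\<close> of
  \<open>act_coeff n m (x\<^sub>1-x\<^sub>2)^(-n-m-1) (1+x\<^sub>2)^m\<close> and of \<open>act_coeff n m x\<^sub>1^(-n-m-1)\<close> are both
  expansions of \<open>(1+x\<^sub>1)^(-n-1)\<close> for large \<open>x\<^sub>1\<close>. The lemma compares the coefficients of
  \<open>x\<^sub>1^(-n-s-1)\<close>, with \<open>x\<close> for \<open>x\<^sub>2\<close>; trinomial revision reduces it to the binomial expansion of
  \<open>((1+x) - x)^s\<close>.
\<close>

lemma lkernel_reexpansion:
  "(\<Sum>m\<le>s. fls_const (act_coeff n m * ((-1) ^ (s - m) * (of_int (- int n - int m - 1) gchoose (s - m))))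
      * xmon (int (s - m)) (int m)) = fls_const (act_coeff n s)"
proof -
  \<comment> \<open>Trinomial revision, written with the summands of \<open>((1+x) + (-x))^s\<close>.\<close>
  have "fls_const (act_coeff n m * ((-1) ^ (s - m) *
      (of_int (- int n - int m - 1) gchoose (s - m)))) * xmon (int (s - m)) (int m)
     = fls_const (act_coeff n s) * (of_nat (s choose m) * (1 + fls_X) ^ m * (- fls_X) ^ (s - m))" if
         "m \<le> s" for m
  proof -
    have "act_coeff n m * (of_int (- int n - int m - 1) gchoose (s - m)) = act_coeff n s * of_nat
        (s choose m)"
      using gbinomial_trinomial_revision[OF that, of "- of_nat n - 1 :: complex"]
      by (simp add: act_coeff_def binomial_gbinomial algebra_simps)
    then have c: "act_coeff n m * ((-1) ^ (s - m) * (of_int (- int n - int m - 1) gchoose (s - m)))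
       = act_coeff n s * of_nat (s choose m) * (-1) ^ (s - m)"
      by (simp only: mult.left_commute[of _ "(-1) ^ (s - m)"]) (simp only: mult.commute)
    have x: "xmon (int (s - m)) (int m) = (1 + fls_X) ^ m * fls_X ^ (s - m)"
      using xmon_mult[of 0 "int m" "int (s - m)" 0] by (simp only: xmon_0_nat xmon_nat_0) simp
    have p: "(- fls_X) ^ (s - m) = fls_const ((-1) ^ (s - m)) * (fls_X :: complex fls) ^ (s - m)"
      by (subst power_minus) (simp add: minus_one_power_iff)
    show ?thesis unfolding c x p fls_of_nat
      by (simp only: fls_const_mult_const[symmetric] ac_simps)
  qed
  then have "(\<Sum>m\<le>s. fls_const (act_coeff n m *
      ((-1) ^ (s - m) * (of_int (- int n - int m - 1) gchoose (s - m))))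
      * xmon (int (s - m)) (int m)) = fls_const (act_coeff n s)
          * (\<Sum>m\<le>s. of_nat (s choose m) * (1 + fls_X) ^ m * (- fls_X) ^ (s - m))"
    by (simp add: sum_distrib_left)
  also have "(\<Sum>m\<le>s. of_nat (s choose m) * (1 + fls_X) ^ m * (- fls_X) ^ (s - m)) = (1 :: complex fls)"
    unfolding binomial_ring[symmetric] by simp
  finally show ?thesis by simp
qed

text \<open>
  Weighted residues with these kernels lie in \<open>O'\<close> (\<open>wres_tail_kernels\<close>), including those with an
  exponent of \<open>x\<close> below the one that occurs in the definition of \<open>O'\<close>.
\<close>

inductive_set tail_kernels :: "nat \<Rightarrow> complex fls set" for n where
  tail_kernels_zero: "0 \<in> tail_kernels n"
| tail_kernels_add: "f \<in> tail_kernels n \<Longrightarrow> a \<le> - 2 * int n - 2 \<Longrightarrow> f + fls_const c * xmon a (int n)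
    \<in> tail_kernels n"

lemma tail_kernels_plus: "g \<in> tail_kernels n \<Longrightarrow> f \<in> tail_kernels n \<Longrightarrow> f + g \<in> tail_kernels n"
proof (induction g arbitrary: f rule: tail_kernels.induct)
  case (tail_kernels_add g a c)
  then show ?case using tail_kernels.tail_kernels_add[of "f + g" n a c] by (simp add: add.assoc)
qed simp

lemma tail_kernels_xmon: "a \<le> - 2 * int n - 2 \<Longrightarrow> xmon a (int n) \<in> tail_kernels n"
  using tail_kernels.tail_kernels_add[OF tail_kernels.tail_kernels_zero, of a n 1] by simp

lemma tail_kernels_const: "f \<in> tail_kernels n \<Longrightarrow> fls_const c * f \<in> tail_kernels n"
proof (induction f rule: tail_kernels.induct)
  case (tail_kernels_add g a d)
  then show ?case using tail_kernels.tail_kernels_add[of "fls_const c * g" n a "c * d"]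
      by (simp add: distrib_left flip: mult.assoc)
qed (simp add: tail_kernels_zero)

lemma tail_kernels_sum: "(\<And>i. i \<in> A \<Longrightarrow> f i \<in> tail_kernels n) \<Longrightarrow> sum f A \<in> tail_kernels n"
  by (induction A rule: infinite_finite_induct) (auto intro: tail_kernels_plus tail_kernels_zero)

text \<open>
  Expanding the surplus factor \<open>(1+x)^(c-n)\<close> raises the exponent of \<open>x\<close> by at most \<open>c - n\<close>.
\<close>

lemma tail_kernels_xmon_ge:
  assumes "c \<ge> int n" "a + c \<le> - int n - 2"
  shows "xmon a c \<in> tail_kernels n"
  using assms
proof (induction c arbitrary: a rule: int_ge_induct)
  case (step c)
  have "xmon a c \<in> tail_kernels n" "xmon (a + 1) c \<in> tail_kernels n"
    using step by auto
  then show ?case by (simp add: xmon_split tail_kernels_plus)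
qed (simp add: tail_kernels_xmon)

section \<open>Moving the pole of the right kernel\<close>

text \<open>
  The power \<open>(x-y)^l\<close>, expanded in nonnegative powers of \<open>y\<close>: a power series in \<open>y\<close> whose
  coefficients are Laurent series in \<open>x\<close>.
\<close>

definition diff_power :: "int \<Rightarrow> complex fls fps" where
  "diff_power l = Abs_fps (\<lambda>i. fls_const ((-1) ^ i * (of_int l gchoose i)) * xmon (l - int i) 0)"

lemma diff_power_deriv: "fps_deriv (diff_power l) = - fps_const (of_int l) * diff_power (l - 1)"
proof (rule fps_ext)
  fix i
  have "(of_nat (Suc i) * (of_int l gchoose Suc i) :: complex) = of_int l * (of_int (l - 1) gchoose i)"
    by (simp only: gbinomial_absorption of_int_diff of_int_1)
  then have "of_nat (Suc i) * ((-1) ^ Suc i * (of_int l gchoose Suc i) :: complex)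
     = - of_int l * ((-1) ^ i * (of_int (l - 1) gchoose i))"
    by (simp only: power_Suc mult_minus_left mult_minus_right mult.left_commute[of
        "of_nat (Suc i)"] mult.left_commute[of "of_int l"]) simp
  then have "(of_nat (Suc i) :: complex fls) * fls_const ((-1) ^ Suc i * (of_int l gchoose Suc i))
     = - of_int l * fls_const ((-1) ^ i * (of_int (l - 1) gchoose i))"
    unfolding fls_of_nat fls_of_int fls_const_mult_const fls_const_uminus[symmetric] by (rule arg_cong)
  then show "fps_nth (fps_deriv (diff_power l)) i
      = fps_nth (- fps_const (of_int l) * diff_power (l - 1)) i"
    by (simp add: diff_power_def del: of_nat_Suc power_Suc flip: mult.assoc) (simp add: algebra_simps)
qed

lemma diff_power_mult: "(fps_const (xmon 1 0) - fps_X) * diff_power l = diff_power (l + 1)"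
proof (rule fps_ext)
  fix i
  show "fps_nth ((fps_const (xmon 1 0) - fps_X) * diff_power l) i = fps_nth (diff_power (l + 1)) i"
  proof (cases i)
    case 0
    then show ?thesis by (simp add: diff_power_def left_diff_distrib xmon_mult add.commute)
  next
    case (Suc j)
    have "((-1) ^ Suc j * (of_int l gchoose Suc j) - (-1) ^ j * (of_int l gchoose j) :: complex)
        = (-1) ^ Suc j * (of_int (l + 1) gchoose Suc j)"
      by (simp add: gbinomial_addition_formula[of "of_int l + 1 :: complex" j] distrib_left)
    moreover have "l - int (Suc j) + 1 = l - int j" "l + 1 - int (Suc j) = l - int j" by simp_all
    moreover have "xmon 1 0 * (c * xmon p 0) = c * xmon (p + 1) 0" for c p
      using xmon_mult[of 1 0 p 0] by (simp add: mult.left_commute add.commute)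
    ultimately show ?thesis
      by (simp only: Suc diff_power_def left_diff_distrib fps_sub_nth fps_mult_left_const_nth fps_nth_Abs_fps)
        (simp only: fps_X_mult_nth fps_nth_Abs_fps diff_Suc_1 nat.distinct
            if_False left_diff_distrib[symmetric]
          fls_minus_const)
  qed
qed

text \<open>
  The right kernel with its pole moved from \<open>x = 0\<close> to \<open>x = y\<close>. Its coefficients are the kernels
  for \<open>v\<close> that appear in the Jacobi identity for the commutator operator of a product.
\<close>

definition rkernel_series :: "nat \<Rightarrow> complex fls fps" where
  "rkernel_series n = (\<Sum>m=0..n. fps_const
      (fls_const (act_coeff n m * (-1) ^ (n + m)) * xmon 0 (int m - 1))
     * diff_power (- int n - int m - 1))"

lemma rkernel_series_nth: "fps_nth (rkernel_series n) i = (\<Sum>m=0..n.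
    fls_const (act_coeff n m * (-1) ^ (n + m) * ((-1) ^ i * (of_int (- int n - int m - 1) gchoose i)))
      * (xmon 0 (-1) * xmon (- int n - int m - 1 - int i) (int m)))"
proof -
  have "xmon 0 (int m - 1) * (fls_const c * xmon p 0) = fls_const c *
      (xmon 0 (-1) * xmon p (int m))" for m c p
    by (simp add: mult.left_commute[of "xmon 0 _"] xmon_mult)
  then show ?thesis
    by (simp only: rkernel_series_def fps_sum_nth fps_mult_left_const_nth diff_power_def fps_nth_Abs_fps mult.assoc)
      (simp add: mult.assoc flip: fls_const_mult_const)
qed

text \<open>
  The factor \<open>(1+y)^(n+1)\<close> makes the \<open>y\<close>-derivative telescope.
\<close>

definition rkernel_lift :: "nat \<Rightarrow> complex fls fps" where
  "rkernel_lift n = rkernel_series n * (1 + fps_X) ^ (n + 1)"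

lemma rkernel_lift_0: "fps_nth (rkernel_lift n) 0 = rkernel n"
  by (simp add: rkernel_lift_def rkernel_series_def rkernel_alt fps_sum_nth diff_power_def fps_power_zeroth mult.assoc xmon_mult)

text \<open>
  With \<open>1+y = (1+x) - (x-y)\<close> the derivative of the \<open>m\<close>-th summand is the difference of two
  consecutive terms \<open>T\<close>.
\<close>

lemma deriv_rkernel_lift: "fps_deriv (rkernel_lift n) =
   fps_const (fls_const (- of_nat (n + 1) * act_coeff n (n + 1)) * xmon 0 (int n)) *
       ((1 + fps_X) ^ n * diff_power (- 2 * int n - 2))"
proof -
  define T where "T m = fps_const (fls_const (of_nat m * (act_coeff n m * (-1) ^ (n + m))) * xmon 0
      (int m - 1))
     * ((1 + fps_X) ^ n * diff_power (- int n - int m - 1))" for m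
  have "fps_deriv (rkernel_lift n) = (\<Sum>m=0..n. T (Suc m) - T m)"
    unfolding rkernel_lift_def rkernel_series_def sum_distrib_right fps_deriv_sum
  proof (rule sum.cong)
    fix m
    define p where "p = - int n - int m - 2"
    define c where "c = act_coeff n m * (-1) ^ (n + m)"
    define u :: "complex fls fps" where "u = 1 + fps_X"
    define z where "z = fps_const (xmon 0 (int m - 1))"
    define C where "C = fps_const (fls_const c)"
    define N :: "complex fls fps" where "N = of_nat n"
    define M :: "complex fls fps" where "M = of_nat m"
    have p: "- int n - int m - 1 = p + 1" "- int n - int (Suc m) - 1 = p" "p + 1 - 1 = p"
      "- int n - int m - 1 - 1 = p"
      by (simp_all add: p_def)
    have q: "fps_const (of_int (p + 1)) = - (N + M + 1)"
      by (simp add: p_def N_def M_def fps_of_nat flip: fps_const_add fps_const_neg fps_const_sub)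
    have s: "int (Suc m) - 1 = int m" by simp
    have "xmon 0 (int m) = xmon 0 1 * xmon 0 (int m - 1)" by (simp add: xmon_mult)
    then have z: "fps_const (fls_const c * xmon 0 (int m - 1)) = C * z"
      "fps_const (fls_const (of_nat (n + m + 1) * c) * xmon 0 (int m)) = (N + M + 1) * C * z
          * fps_const (xmon 0 1)"
      "fps_const (fls_const (of_nat m * c) * xmon 0 (int m - 1)) = M * C * z"
      by (simp_all add: C_def z_def N_def M_def fls_const_of_nat_mult fps_of_nat
         del: fls_const_mult_const fps_const_mult flip: fps_const_mult of_nat_add)
            (simp_all add: ac_simps flip: fls_const_mult_const fps_const_mult
            fls_plus_const fps_const_add fls_of_nat fps_of_nat)
    have u': "fps_deriv (u ^ (n + 1)) = (N + 1) * u ^ n"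
    proof -
      have "fps_deriv u = 1" by (simp add: u_def)
      then show ?thesis
        by (simp only: fps_deriv_power mult_1_right fps_of_nat N_def add_diff_cancel_right')
          (simp only: of_nat_add of_nat_1)
    qed
    have "xmon 0 1 = 1 + xmon 1 0" using xmon_split[of 0 0] by simp
    then have "u = fps_const (xmon 0 1) - (fps_const (xmon 1 0) - fps_X)"
      by (simp add: u_def flip: fps_const_add)
    then have uD: "u * diff_power p = fps_const (xmon 0 1) * diff_power p - diff_power (p + 1)"
      by (simp only: left_diff_distrib[of "fps_const (xmon 0 1)"] diff_power_mult)
    have "fps_deriv (C * z) = 0" by (simp add: C_def z_def)
    then have "fps_deriv (C * z * diff_power (p + 1) * u ^ (n + 1))
       = C * z * (u ^ n * ((N + M + 1) * (u * diff_power p)) + (N + 1) * u ^ n * diff_power (p + 1))"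
      by (simp only: fps_deriv_mult u' diff_power_deriv p q) (simp add: algebra_simps)
    also have "\<dots> = (N + M + 1) * C * z * fps_const (xmon 0 1) * (u ^ n * diff_power p) - M * C * z *
        (u ^ n * diff_power (p + 1))"
      by (simp only: uD) (simp add: algebra_simps)
    finally show "fps_deriv (fps_const (fls_const (act_coeff n m * (-1) ^ (n + m)) * xmon 0 (int m - 1))
     * diff_power (- int n - int m - 1) * (1 + fps_X) ^ (n + 1)) = T (Suc m) - T m"
      unfolding T_def act_coeff_Suc_sign p s unfolding c_def[symmetric] u_def[symmetric] z .
  qed simp
  also have "\<dots> = T (Suc n) - T 0"
    by (simp only: atLeast0AtMost flip: lessThan_Suc_atMost) (rule sum_lessThan_telescope)
  finally have D: "fps_deriv (rkernel_lift n) = T (Suc n) - T 0" .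
  have f: "T 0 = 0" "(-1 :: complex) ^ (n + Suc n) = -1" "- int n - int (Suc n) - 1 = - 2 * int n - 2"
    "int (Suc n) - 1 = int n" "of_nat (n + 1) = (of_nat (Suc n) :: complex)"
    by (simp_all add: T_def minus_one_power_iff)
  have "T (Suc n) = fps_const (fls_const (of_nat (Suc n) * (act_coeff n (Suc n) * -1)) * xmon 0 (int n))
      * ((1 + fps_X) ^ n * diff_power (- 2 * int n - 2))"
    by (simp only: T_def f)
  then show ?thesis
    unfolding D f by (simp only: diff_zero mult_minus1_right mult_minus_left mult_minus_right mult_1_right Suc_eq_plus1)
qed

text \<open>
  The \<open>y\<close>-derivative is a multiple of \<open>(1+x)^n (1+y)^n (x-y)^(-2n-2)\<close>, in whose expansion all
  powers of \<open>x\<close> beside the factor \<open>(1+x)^n\<close> are at most \<open>-2n-2\<close>.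
\<close>

lemma rkernel_lift_Suc_tail_kernels: "fps_nth (rkernel_lift n) (Suc r) \<in> tail_kernels n"
proof -
  have "of_nat (Suc r) * fps_nth (rkernel_lift n) (Suc r) = fps_nth (fps_deriv (rkernel_lift n)) r"
    by simp
  also have "\<dots> = fls_const (- of_nat (n + 1) * act_coeff n (n + 1))
      * (\<Sum>i=0..r. fls_const (of_nat (n choose i)) *
      (fls_const ((-1) ^ (r - i) * (of_int (- 2 * int n - 2) gchoose (r - i)))
          * xmon (- 2 * int n - 2 - int (r - i)) (int n)))"
  proof -
    have m: "xmon 0 (int n) * (a * (b * xmon c 0)) = a * (b * xmon c (int n))" for a b c
      using xmon_mult[of 0 "int n" c 0] by (simp add: mult.left_commute)
    show ?thesis unfolding deriv_rkernel_lift fps_mult_left_const_nth fps_mult_nth[of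
        "_ ^ _"] one_plus_fps_X_power_nth mult.assoc
      by (subst sum_distrib_left) (simp only: diff_power_def fps_nth_Abs_fps m)
  qed
  also have "\<dots> \<in> tail_kernels n"
    by (intro tail_kernels_const tail_kernels_sum tail_kernels_xmon) simp
  finally have "fls_const (inverse (of_nat (Suc r))) *
      (of_nat (Suc r) * fps_nth (rkernel_lift n) (Suc r)) \<in> tail_kernels n"
    by (rule tail_kernels_const)
  also have "fls_const (inverse (of_nat (Suc r))) *
      (of_nat (Suc r) * fps_nth (rkernel_lift n) (Suc r)) = fps_nth (rkernel_lift n) (Suc r)"
    by (simp add: fls_of_nat del: of_nat_Suc flip: mult.assoc)
  finally show ?thesis .
qed

section \<open>Residues and the Jacobi identity\<close>

context weak_module
begin

sublocale W: vector_space "smul W" by (rule vector_space_W)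

sublocale state: Vector_Spaces.linear "smul V" "smul W" "\<lambda>v. mode W v m w" for m w
    by (rule linear_state)

sublocale mode: Vector_Spaces.linear "smul W" "smul W" "mode W v m" for v m by (rule linear_mode)

lemma finite_modes: "finite {k. smul W (fls_nth f k) (mode W v k w) \<noteq> 0}"
proof -
  obtain N where N: "\<forall>m\<ge>N. mode W v m w = 0" using truncation by blast
  obtain M where M: "ord_ge M f" using ord_ge_exists by blast
  have "{k. smul W (fls_nth f k) (mode W v k w) \<noteq> 0} \<subseteq> {M..<N}"
    using N M by (auto simp: ord_ge_def not_le[symmetric])
  then show ?thesis by (rule finite_subset) simp
qed

lemma res_Y_add_kernel: "res_Y W (f + g) v w = res_Y W f v w + res_Y W g v w"
  using Sum_any.distrib[OF finite_modes finite_modes] by (simp add: res_Y_def W.scale_left_distrib)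

lemma res_Y_eq_0: "(\<And>k. fls_nth f k \<noteq> 0 \<Longrightarrow> mode W v k w = 0) \<Longrightarrow> res_Y W f v w = 0"
proof -
  assume "\<And>k. fls_nth f k \<noteq> 0 \<Longrightarrow> mode W v k w = 0"
  then have "(\<lambda>k. smul W (fls_nth f k) (mode W v k w)) = (\<lambda>k. 0)" by (auto simp: fun_eq_iff)
  then show ?thesis by (simp only: res_Y_def) simp
qed

lemma smul_Sum_any:
  assumes "finite {k. f k \<noteq> 0}"
  shows "smul W c (Sum_any f) = Sum_any (\<lambda>k. smul W c (f k))"
proof -
  have "Sum_any (\<lambda>k. smul W c (f k)) = (\<Sum>k\<in>{k. f k \<noteq> 0}. smul W c (f k))"
    using assms by (intro Sum_any.expand_superset) auto
  then show ?thesis by (simp add: Sum_any.expand_set W.scale_sum_right)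
qed

lemma Sum_any_eq_lessThan: "(\<And>i. i \<ge> N \<Longrightarrow> f i = 0) \<Longrightarrow> Sum_any f = (\<Sum>i<N. f i)" for f :: "nat \<Rightarrow> 'w"
  by (rule Sum_any.expand_superset) (auto simp: not_less[symmetric])

lemma res_Y_scale_kernel: "res_Y W (fls_const c * f) v w = smul W c (res_Y W f v w)"
  unfolding res_Y_def smul_Sum_any[OF finite_modes] by simp

lemma res_Y_add_state: "res_Y W f (u + v) w = res_Y W f u w + res_Y W f v w"
  unfolding res_Y_def using Sum_any.distrib[OF finite_modes finite_modes]
  by (simp add: state.add W.scale_right_distrib)

lemma res_Y_scale_state: "res_Y W f (smul V c v) w = smul W c (res_Y W f v w)"
  unfolding res_Y_def smul_Sum_any[OF finite_modes] by (simp add: state.scale mult.commute)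

lemma res_Y_add: "res_Y W f v (w + w') = res_Y W f v w + res_Y W f v w'"
  unfolding res_Y_def using Sum_any.distrib[OF finite_modes finite_modes]
  by (simp add: mode.add W.scale_right_distrib)

lemma res_Y_scale: "res_Y W f v (smul W c w) = smul W c (res_Y W f v w)"
  unfolding res_Y_def smul_Sum_any[OF finite_modes] by (simp add: mode.scale mult.commute)

lemma res_Y_monom: "res_Y W (xmon a 0) v w = mode W v a w"
proof -
  have "res_Y W (xmon a 0) v w = Sum_any (\<lambda>k. if k = a then mode W v a w else 0)"
    unfolding res_Y_def by (rule Sum_any.cong) (simp add: xmon_monom_nth)
  then show ?thesis by simp
qed

lemma res_Y_vac: "res_Y W f (vac V) w = smul W (fls_nth f (-1)) w"
proof -
  have "res_Y W f (vac V) w = Sum_any (\<lambda>k::int. if k = -1 then smul W (fls_nth f (-1)) w else 0)"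
    unfolding res_Y_def by (rule Sum_any.cong) (simp add: vacuum)
  then show ?thesis by simp
qed

text \<open>
  Linear maps on Laurent series that are continuous for the \<open>x\<close>-adic topology. They are
  determined by their values at the powers of \<open>x\<close> (\<open>cont_fun_eq\<close>), which extends the Jacobi
  identity from modes to arbitrary kernels.
\<close>

definition cont_fun :: "(complex fls \<Rightarrow> 'w) \<Rightarrow> bool" where
  "cont_fun \<phi> \<longleftrightarrow> (\<forall>f g. \<phi> (f + g) = \<phi> f + \<phi> g) \<and> (\<forall>c f. \<phi> (fls_const c * f) = smul W c (\<phi> f))
     \<and> (\<exists>M. \<forall>f. ord_ge M f \<longrightarrow> \<phi> f = 0)"

lemma cont_fun_res_deriv: "cont_fun (\<lambda>f. res_Y W (q * (fls_deriv ^^ i) f) v w)"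
proof -
  obtain N where N: "\<forall>m\<ge>N. mode W v m w = 0" using truncation by blast
  obtain M where M: "ord_ge M q" using ord_ge_exists by blast
  have "res_Y W (q * (fls_deriv ^^ i) f) v w = 0" if "ord_ge (N - M + int i) f" for f
  proof -
    have "ord_ge (M + (N - M + int i - int i)) (q * (fls_deriv ^^ i) f)"
      using M that by (intro ord_ge_mult ord_ge_deriv)
    then show ?thesis using N by (intro res_Y_eq_0) (auto simp: ord_ge_def not_le[symmetric])
  qed
  then show ?thesis unfolding cont_fun_def
    by (auto simp: higher_deriv_add higher_deriv_const distrib_left res_Y_add_kernel
      res_Y_scale_kernel mult.left_commute[of q])
qed

lemma cont_fun_res: "cont_fun (\<lambda>f. res_Y W (q * f) v w)"
  using cont_fun_res_deriv[of q 0 v w] by simp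

lemma cont_fun_res': "cont_fun (\<lambda>f. res_Y W (f * q) v w)"
  using cont_fun_res[of q v w] by (simp only: mult.commute)

lemma cont_fun_diff: "cont_fun \<phi> \<Longrightarrow> cont_fun \<psi> \<Longrightarrow> cont_fun (\<lambda>f. \<phi> f - \<psi> f)"
  unfolding cont_fun_def
proof safe
  fix M N
  assume "\<forall>f. ord_ge M f \<longrightarrow> \<phi> f = 0" "\<forall>f. ord_ge N f \<longrightarrow> \<psi> f = 0"
  then show "\<exists>M. \<forall>f. ord_ge M f \<longrightarrow> \<phi> f - \<psi> f = 0"
    using ord_ge_mono by (intro exI[of _ "max M N"]) (metis diff_self max.cobounded1 max.cobounded2)
qed (auto simp: W.scale_right_diff_distrib)

lemma cont_fun_scale: "cont_fun \<phi> \<Longrightarrow> cont_fun (\<lambda>f. smul W c (\<phi> f))"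
  unfolding cont_fun_def by (metis W.scale_right_distrib W.scale_left_commute W.scale_zero_right)

lemma cont_fun_image: "cont_fun \<phi> \<Longrightarrow> cont_fun (\<lambda>f. res_Y W q v (\<phi> f))"
  unfolding cont_fun_def by (metis res_Y_add res_Y_scale W.scale_zero_left)

lemma cont_fun_sum: "finite A \<Longrightarrow> (\<And>i. i \<in> A \<Longrightarrow> cont_fun (\<phi> i)) \<Longrightarrow> cont_fun (\<lambda>f. \<Sum>i\<in>A. \<phi> i f)"
proof (induction A rule: finite_induct)
  case empty
  show ?case by (simp add: cont_fun_def)
next
  case (insert j A)
  have neg: "cont_fun (\<lambda>f. - (\<Sum>i\<in>A. \<phi> i f))"
    using cont_fun_scale[of "\<lambda>f. \<Sum>i\<in>A. \<phi> i f" "-1"] insert by simp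
  show ?case using cont_fun_diff[OF _ neg, of "\<phi> j"] insert by simp
qed

text \<open>
  Peeling off the lowest term of \<open>f\<close> repeatedly raises its order until \<open>\<phi>\<close> vanishes by continuity.
\<close>

lemma cont_fun_zero:
  assumes \<phi>: "cont_fun \<phi>" and monom: "\<And>k. k \<ge> a \<Longrightarrow> \<phi> (xmon k 0) = 0" and f: "ord_ge a f"
  shows "\<phi> f = 0"
proof -
  obtain M where M: "\<And>f. ord_ge M f \<Longrightarrow> \<phi> f = 0"
    using \<phi> unfolding cont_fun_def by blast
  have add: "\<phi> (f + g) = \<phi> f + \<phi> g" and scale: "\<phi> (fls_const c * f) = smul W c (\<phi> f)" for c f g
    using \<phi> unfolding cont_fun_def by blast+
  \<comment> \<open>The number \<open>n\<close> counts the orders missing to reach \<open>M\<close>.\<close>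
  have "\<phi> f = 0" if "ord_ge (M - int n) f" "ord_ge a f" for n f
    using that
  proof (induction n arbitrary: f)
    case 0
    then show ?case using M by simp
  next
    case (Suc n)
    define j where "j = M - int (Suc n)"
    define g where "g = f + fls_const (- fls_nth f j) * xmon j 0"
    have "ord_ge (M - int n) g"
      using Suc.prems(1) by (auto simp: g_def ord_ge_def j_def xmon_monom_nth)
    moreover have "ord_ge a g"
      using Suc.prems(2) by (auto simp: g_def ord_ge_def xmon_monom_nth)
    ultimately have "\<phi> g = 0" by (rule Suc.IH)
    moreover have "\<phi> g = \<phi> f + smul W (- fls_nth f j) (\<phi> (xmon j 0))"
      unfolding g_def add scale ..
    moreover have "smul W (- fls_nth f j) (\<phi> (xmon j 0)) = 0"
      using monom[of j] Suc.prems(2) by (cases "j \<ge> a") (auto simp: ord_ge_def)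
    ultimately show ?case by simp
  qed
  from this[of "nat (M - a)" f] f show ?thesis
    by (cases "M \<ge> a") (use ord_ge_mono[of a f M] in \<open>auto intro: M\<close>)
qed

lemma cont_fun_eq:
  assumes "cont_fun \<phi>" "cont_fun \<psi>" "\<And>k. k \<ge> a \<Longrightarrow> \<phi> (xmon k 0) = \<psi> (xmon k 0)" "ord_ge a f"
  shows "\<phi> f = \<psi> f"
  using cont_fun_zero[OF cont_fun_diff[OF assms(1,2)], of a f] assms(3,4) by simp

text \<open>
  The Jacobi identity for the test function \<open>(x\<^sub>1-x\<^sub>2)^l g(x\<^sub>1) h(x\<^sub>2)\<close>. On the right,
  \<open>x\<^sub>1 = x\<^sub>2 + x\<^sub>0\<close>, and the \<open>i\<close>-th derivative of \<open>g\<close> divided by \<open>i!\<close> is the coefficient of \<open>x\<^sub>0^i\<close> in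
  \<open>g(x\<^sub>2+x\<^sub>0)\<close>. The bound \<open>I\<close> serves all kernels of order at least \<open>a\<close> and \<open>b\<close> at once, so that both
  sides are continuous in \<open>g\<close> and in \<open>h\<close>.
\<close>

lemma jacobi_res_bound:
  assumes g: "ord_ge a g" and h: "ord_ge b h"
    and I: "\<forall>i\<ge>I. mode W u (a + int i) w = 0" "\<forall>i\<ge>I. mode W v (b + int i) w = 0"
      "\<forall>i\<ge>I. mode V u (l + int i) v = 0"
  shows "(\<Sum>i<I. smul W ((-1) ^ i * (of_int l gchoose i))
       (res_Y W (xmon (l - int i) 0 * g) u (res_Y W (xmon (int i) 0 * h) v w)
        - smul W ((-1) powi l) (res_Y W (xmon (l - int i) 0 * h) v (res_Y W (xmon (int i) 0 * g) u w))))
     = (\<Sum>i<I. smul W (1 / fact i) (res_Y W (h * (fls_deriv ^^ i) g) (mode V u (l + int i) v) w))"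
    (is "?L g h = ?R g h")
proof -
  have modeI: "mode W u (m + int i) w = 0" if "i \<ge> I" "m \<ge> a" for m i
    using I(1)[rule_format, of "nat (m - a) + i"] that by (simp add: algebra_simps)
  have modeI': "mode W v (p + int i) w = 0" if "i \<ge> I" "p \<ge> b" for p i
    using I(2)[rule_format, of "nat (p - b) + i"] that by (simp add: algebra_simps)
  have monom: "?L (xmon m 0) (xmon p 0) = ?R (xmon m 0) (xmon p 0)" if "m \<ge> a" "p \<ge> b" for m p
  proof -
    have "?L (xmon m 0) (xmon p 0) = (\<Sum>i<I. smul W ((-1) ^ i * (of_int l gchoose i))
        (mode W u (m + l - int i) (mode W v (p + int i) w)
          - smul W ((-1) powi l) (mode W v (p + l - int i) (mode W u (m + int i) w))))"
      by (simp add: xmon_mult res_Y_monom algebra_simps)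
    also have "\<dots> = Sum_any (\<lambda>i::nat. smul W ((-1) ^ i * (of_int l gchoose i))
        (mode W u (m + l - int i) (mode W v (p + int i) w)
          - smul W ((-1) powi l) (mode W v (p + l - int i) (mode W u (m + int i) w))))"
    proof (rule Sum_any.expand_superset[symmetric])
      show "{i. smul W ((-1) ^ i * (of_int l gchoose i))
        (mode W u (m + l - int i) (mode W v (p + int i) w)
          - smul W ((-1) powi l) (mode W v (p + l - int i) (mode W u (m + int i) w))) \<noteq> 0} \<subseteq> {..<I}"
      proof (rule subsetI, rule ccontr)
        fix i assume i: "i \<in> {i. smul W ((-1) ^ i * (of_int l gchoose i))
        (mode W u (m + l - int i) (mode W v (p + int i) w)
          - smul W ((-1) powi l) (mode W v (p + l - int i) (mode W u (m + int i) w))) \<noteq> 0}" "i \<notin> {..<I}"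
        then have "mode W u (m + int i) w = 0" "mode W v (p + int i) w = 0"
          using modeI modeI' that by auto
        with i show False by (simp add: mode.zero)
      qed
    qed simp
    also have "\<dots> = Sum_any (\<lambda>i::nat. smul W (of_int m gchoose i)
          (mode W (mode V u (l + int i) v) (m + p - int i) w))"
      by (rule jacobi)
    also have "\<dots> = (\<Sum>i<I. smul W (of_int m gchoose i)
          (mode W (mode V u (l + int i) v) (m + p - int i) w))"
      using I(3) by (intro Sum_any.expand_superset) (auto simp: not_less[symmetric])
    also have "\<dots> = ?R (xmon m 0) (xmon p 0)"
    proof (intro sum.cong refl)
      fix i
      have e: "xmon p 0 * (fls_const c * xmon (m - int i) 0) = fls_const c * xmon (m + p - int i) 0"
          for c
        using xmon_mult[of p 0 "m - int i" 0] by (simp add: mult.left_commute algebra_simps)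
      show "smul W (of_int m gchoose i) (mode W (mode V u (l + int i) v) (m + p - int i) w)
         = smul W (1 / fact i) (res_Y W (xmon p 0 * (fls_deriv ^^ i) (xmon m 0))
            (mode V u (l + int i) v) w)"
        by (simp only: higher_deriv_xmon_monom e res_Y_scale_kernel res_Y_monom W.scale_scale) simp
    qed
    finally show ?thesis .
  qed
  have step: "?L (xmon m 0) h = ?R (xmon m 0) h" if "m \<ge> a" for m
  proof (rule cont_fun_eq[where \<phi> = "?L (xmon m 0)" and \<psi> = "?R (xmon m 0)", OF _ _ _ h])
    show "cont_fun (?L (xmon m 0))"
      by (intro cont_fun_sum cont_fun_diff cont_fun_scale cont_fun_image cont_fun_res finite_lessThan)
    show "cont_fun (?R (xmon m 0))"
      by (intro cont_fun_sum cont_fun_scale cont_fun_res' finite_lessThan)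
  qed (rule monom[OF that])
  show ?thesis
  proof (rule cont_fun_eq[where \<phi> = "\<lambda>g. ?L g h" and \<psi> = "\<lambda>g. ?R g h", OF _ _ step g])
    show "cont_fun (\<lambda>g. ?L g h)"
      by (intro cont_fun_sum cont_fun_diff cont_fun_scale cont_fun_image cont_fun_res finite_lessThan)
    show "cont_fun (\<lambda>g. ?R g h)"
      by (intro cont_fun_sum cont_fun_scale cont_fun_res_deriv finite_lessThan)
  qed
qed

lemma commutator_formula:
  "mode W u m (mode W v p w) - mode W v p (mode W u m w)
     = Sum_any (\<lambda>i::nat. smul W (of_int m gchoose i) (mode W (mode V u (int i) v) (m + p - int i) w))"
proof -
  have "Sum_any (\<lambda>i::nat. smul W ((-1) ^ i * (of_int 0 gchoose i))
        (mode W u (m + 0 - int i) (mode W v (p + int i) w)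
          - smul W ((-1) powi 0) (mode W v (p + 0 - int i) (mode W u (m + int i) w))))
      = Sum_any (\<lambda>i::nat. if i = 0 then mode W u m (mode W v p w) - mode W v p (mode W u m w) else 0)"
    by (rule Sum_any.cong) (simp add: gbinomial_0_left)
  then show ?thesis using jacobi[of 0 u m v p w] by simp
qed

lemma commutator_1: "mode W u 1 (mode W v p w) - mode W v p (mode W u 1 w)
   = mode W (mode V u 0 v) (p + 1) w + mode W (mode V u 1 v) p w"
proof -
  have "(1 :: complex) gchoose i = 0" if "i \<ge> 2" for i
    using that gchoose_of_nat_eq_0[of 1 i] by simp
  then show ?thesis
    unfolding commutator_formula
    by (subst Sum_any_eq_lessThan[of 2]) (auto simp: numeral_2_eq_2 add.commute)
qed

end

section \<open>Weights\<close>

context voa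
begin

lemma vac_weight: "vac V \<in> wt_space V 0"
  by (simp add: wt_space_def Lop_def creation)

lemma virasoro_0: "n \<noteq> 0 \<Longrightarrow> Lop V 0 (Lop V n v) - Lop V n (Lop V 0 v) = smul V (of_int (- n))
    (Lop V n v)"
proof -
  assume n: "n \<noteq> 0"
  obtain c where "\<forall>m n v. Lop V m (Lop V n v) - Lop V n (Lop V m v)
        = smul V (of_int (m - n)) (Lop V (m + n) v)
          + (if m + n = 0 then smul V (of_int (m ^ 3 - m) / 12 * c) v else 0)"
    using virasoro by blast
  from this[rule_format, of 0 n v] n show ?thesis by simp
qed

lemma Lop_minus_1_weight:
  assumes "v \<in> wt_space V k"
  shows "Lop V (-1) v \<in> wt_space V (k + 1)"
proof -
  have "Lop V 0 (Lop V (-1) v) = Lop V (-1) (Lop V 0 v) + Lop V (-1) v"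
    using virasoro_0[of "-1" v] by (simp add: diff_eq_eq add.commute)
  then show ?thesis using assms
    by (simp add: wt_space_def Lop_def mode.scale W.scale_left_distrib)
qed

text \<open>
  The conformal vector is \<open>L(-2)\<close> applied to the vacuum, and \<open>[L(0), L(-2)] = 2 L(-2)\<close>.
\<close>

lemma conf_weight: "conf V \<in> wt_space V 2"
proof -
  have c: "Lop V (-2) (vac V) = conf V" using creation_lim[of "conf V"] by (simp add: Lop_def)
  have "Lop V 0 (vac V) = 0" by (simp add: Lop_def creation)
  then show ?thesis using virasoro_0[of "-2" "vac V"] by (simp add: c wt_space_def) (simp add: Lop_def)
qed

text \<open>
  The commutator with \<open>L(0)\<close> involves \<open>L(-1)u\<close>, whose modes are given by the derivative property.
\<close>

lemma L0_mode: "Lop V 0 (mode V u m v) = mode V u m (Lop V 0 v) + mode V (Lop V 0 u) m v - smul V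
    (of_int (m + 1)) (mode V u m v)"
proof -
  have "mode V (Lop V (-1) u) (m + 1) v = - smul V (of_int (m + 1)) (mode V u m v)"
    using L_derivative[of u "m + 1" v] by (simp only: W.scale_minus_left of_int_minus) simp
  then have "Lop V 0 (mode V u m v) - mode V u m (Lop V 0 v)
      = - smul V (of_int (m + 1)) (mode V u m v) + mode V (Lop V 0 u) m v"
    using commutator_1[of "conf V" u m v] by (simp add: Lop_def)
  then show ?thesis by (simp add: diff_eq_eq)
qed

lemma mode_weight:
  assumes "u \<in> wt_space V k" "v \<in> wt_space V l"
  shows "mode V u m v \<in> wt_space V (k + l - m - 1)"
proof -
  have "Lop V 0 (mode V u m v) = smul V (of_int l) (mode V u m v) + smul V (of_int k) (mode V u m v)
      - smul V (of_int (m + 1)) (mode V u m v)"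
    using assms unfolding L0_mode by (simp add: wt_space_def mode.scale state.scale)
  also have "\<dots> = smul V (of_int (k + l - m - 1)) (mode V u m v)"
    by (simp add: algebra_simps flip: W.scale_left_distrib W.scale_left_diff_distrib)
  finally show ?thesis
    by (simp add: wt_space_def)
qed

lemma wt_space_zero: "0 \<in> wt_space V k"
  by (simp add: wt_space_def Lop_def mode.zero)

lemma wt_space_add: "u \<in> wt_space V k \<Longrightarrow> v \<in> wt_space V k \<Longrightarrow> u + v \<in> wt_space V k"
  by (simp add: wt_space_def Lop_def mode.add W.scale_right_distrib)

lemma wt_space_scale: "v \<in> wt_space V k \<Longrightarrow> smul V c v \<in> wt_space V k"
  by (simp add: wt_space_def Lop_def mode.scale mult.commute)

lemma hcomp_decomp: "is_decomp V v (hcomp V v)"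
  unfolding hcomp_def by (rule theI'[OF direct_sum])

lemma hcomp_weight: "hcomp V v k \<in> wt_space V k"
  and finite_hcomp: "finite {k. hcomp V v k \<noteq> 0}"
  and Sum_any_hcomp: "Sum_any (hcomp V v) = v"
  using hcomp_decomp[of v] by (auto simp: is_decomp_def)

lemma hcomp_eqI: "is_decomp V v f \<Longrightarrow> hcomp V v = f"
  unfolding hcomp_def by (rule the1_equality[OF direct_sum])

lemma hcomp_add: "hcomp V (u + v) = (\<lambda>k. hcomp V u k + hcomp V v k)"
proof (rule hcomp_eqI, unfold is_decomp_def, intro conjI allI)
  show "finite {k. hcomp V u k + hcomp V v k \<noteq> 0}"
    by (rule finite_subset[OF _ finite_UnI[OF finite_hcomp finite_hcomp], of _ u v]) auto
  show "u + v = Sum_any (\<lambda>k. hcomp V u k + hcomp V v k)"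
    by (simp add: Sum_any.distrib finite_hcomp Sum_any_hcomp)
qed (simp add: hcomp_weight wt_space_add)

lemma hcomp_scale: "hcomp V (smul V c v) = (\<lambda>k. smul V c (hcomp V v k))"
proof (rule hcomp_eqI, unfold is_decomp_def, intro conjI allI)
  show "finite {k. smul V c (hcomp V v k) \<noteq> 0}"
    by (rule finite_subset[OF _ finite_hcomp[of v]]) auto
  show "smul V c v = Sum_any (\<lambda>k. smul V c (hcomp V v k))"
    by (simp add: finite_hcomp Sum_any_hcomp flip: smul_Sum_any)
qed (simp add: hcomp_weight wt_space_scale)

lemma homogeneous_induct [case_names homogeneous add]:
  assumes hom: "\<And>k v. v \<in> wt_space V k \<Longrightarrow> P v"
    and add: "\<And>u v. P u \<Longrightarrow> P v \<Longrightarrow> P (u + v)"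
  shows "P v"
proof -
  have "P (\<Sum>k\<in>A. hcomp V v k)" if "finite A" for A
    using that by (induction A) (auto intro: hom add wt_space_zero hcomp_weight)
  from this[OF finite_hcomp[of v]] show ?thesis
    using Sum_any_hcomp[of v] by (simp add: Sum_any.expand_set)
qed

end

section \<open>Weighted residues\<close>

text \<open>
  The weight factor \<open>(1+x)^(wt v)\<close> is part of the definition, so that kernels do not depend on
  the vector and every identity between kernels extends linearly to vectors that are not
  homogeneous.
\<close>

definition wres :: "('v::ab_group_add, 'z) voa_data_scheme \<Rightarrow>
    ('v, 'w::ab_group_add, 'y) weak_module_data_scheme \<Rightarrow> complex fls \<Rightarrow> 'v \<Rightarrow> 'w \<Rightarrow> 'w" where
  "wres V W g v w = Sum_any (\<lambda>k. res_Y W (g * xmon 0 k) (hcomp V v k) w)"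

locale voa_module = V: voa V + weak_module V W
  for V :: "('v::ab_group_add, 'z) voa_data_scheme"
    and W :: "('v, 'w::ab_group_add, 'y) weak_module_data_scheme"
begin

lemma finite_wres: "finite {k. res_Y W (g k) (hcomp V v k) w \<noteq> 0}"
  by (rule finite_subset[OF _ V.finite_hcomp[of v]]) (auto simp: res_Y_0)

lemma wres_homogeneous: "v \<in> wt_space V k \<Longrightarrow> wres V W g v w = res_Y W (g * xmon 0 k) v w"
proof -
  assume "v \<in> wt_space V k"
  then have "wres V W g v w = Sum_any (\<lambda>j. if j = k then res_Y W (g * xmon 0 k) v w else 0)"
    unfolding wres_def by (intro Sum_any.cong) (simp add: V.hcomp_homogeneous res_Y_0)
  then show ?thesis by simp
qed

lemma wres_add_kernel: "wres V W (f + g) v w = wres V W f v w + wres V W g v w"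
  unfolding wres_def by (simp add: distrib_right res_Y_add_kernel Sum_any.distrib finite_wres)

lemma wres_scale_kernel: "wres V W (fls_const c * f) v w = smul W c (wres V W f v w)"
  unfolding wres_def smul_Sum_any[OF finite_wres] by (simp only: mult.assoc res_Y_scale_kernel)

lemma wres_add_state: "wres V W f (u + v) w = wres V W f u w + wres V W f v w"
  unfolding wres_def by (simp add: V.hcomp_add res_Y_add_state Sum_any.distrib finite_wres)

lemma wres_scale_state: "wres V W f (smul V c v) w = smul W c (wres V W f v w)"
  unfolding wres_def smul_Sum_any[OF finite_wres] by (simp only: V.hcomp_scale res_Y_scale_state)

lemma wres_add: "wres V W f v (w + w') = wres V W f v w + wres V W f v w'"
  unfolding wres_def by (simp add: res_Y_add Sum_any.distrib finite_wres)

lemma wres_scale: "wres V W f v (smul W c w) = smul W c (wres V W f v w)"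
  unfolding wres_def smul_Sum_any[OF finite_wres] by (simp only: res_Y_scale)

sublocale kernel: additive "\<lambda>f. wres V W f v w" for v w
  by unfold_locales (rule wres_add_kernel)

sublocale wstate: additive "\<lambda>v. wres V W f v w" for f w
  by unfold_locales (rule wres_add_state)

sublocale wvec: additive "\<lambda>w. wres V W f v w" for f v
  by unfold_locales (rule wres_add)

lemma lact_wt_eq: "lact_wt W n k v w = res_Y W (lkernel n * xmon 0 k) v w"
proof -
  have "res_Y W (lkernel n * xmon 0 k) v w
    = res_Y W (\<Sum>m=0..n. fls_const (act_coeff n m) * xmon (- int n - int m - 1) (k + int n)) v w"
    by (simp only: lkernel_def sum_distrib_right mult.assoc xmon_mult) (simp add: add.commute)
  also have "\<dots> = (\<Sum>m=0..n. smul W (act_coeff n m)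
      (res_Y W (xmon (- int n - int m - 1) (k + int n)) v w))"
    by (subst additive.sum[OF additive.intro[OF res_Y_add_kernel]]) (simp only: res_Y_scale_kernel)
  finally show ?thesis by (simp only: lact_wt_def act_coeff_def xmon_def)
qed

lemma ract_wt_eq: "ract_wt W n k w v = res_Y W (rkernel n * xmon 0 k) v w"
proof -
  have "res_Y W (rkernel n * xmon 0 k) v w
    = res_Y W (\<Sum>m=0..n. fls_const (act_coeff n m * (-1) ^ (n - m)) * xmon (- int n - int m - 1)
        (k + int m - 1)) v w"
    by (simp only: rkernel_def sum_distrib_right mult.assoc xmon_mult) (simp add: algebra_simps)
  also have "\<dots> = (\<Sum>m=0..n. smul W (act_coeff n m * (-1) ^ (n - m))
      (res_Y W (xmon (- int n - int m - 1) (k + int m - 1)) v w))"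
    by (subst additive.sum[OF additive.intro[OF res_Y_add_kernel]]) (simp only: res_Y_scale_kernel)
  finally show ?thesis by (simp only: ract_wt_def act_coeff_def xmon_def)
qed

lemma lact_eq_wres: "lact V W n v w = wres V W (lkernel n) v w"
  by (simp only: lact_def wres_def lact_wt_eq)

lemma ract_eq_wres: "ract V W n w v = wres V W (rkernel n) v w"
  by (simp only: ract_def wres_def ract_wt_eq)

lemma wres_lkernel: "wres V W (lkernel n) v w
    = (\<Sum>m=0..n. smul W (act_coeff n m) (wres V W (xmon (- int n - int m - 1) (int n)) v w))"
  by (simp only: lkernel_def kernel.sum wres_scale_kernel)

lemma rkernel_eq: "wres V W (rkernel n) v w = wres V W (lkernel n) v w - wres V W (xmon 0 (-1)) v w"
  using kernel.diff[where v = v and w = w, of "lkernel n" "rkernel n"]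
      unfolding lkernel_minus_rkernel by simp

text \<open>
  In \<open>V\<close> one has \<open>L(-1)v = v\<^sub>(\<^sub>-\<^sub>2\<^sub>) 1\<close>. The Jacobi identity for \<open>v\<close> and the vacuum with \<open>l = -2\<close>
  expresses the modes of this vector, and one term at most survives because the vacuum acts as
  the identity.
\<close>

lemma mode_derivative: "mode W (Lop V (-1) v) p w = smul W (- of_int p) (mode W v (p - 1) w)"
proof -
  define c :: "nat \<Rightarrow> complex" where "c i = (-1) ^ i * (of_int (-2) gchoose i)" for i
  have c: "c i = of_nat (Suc i)" for i
  proof -
    have "(-2 :: complex) gchoose i = (-1) ^ i * (of_nat (Suc i) gchoose i)"
      using gbinomial_minus[of "2 :: complex" i] by simp
    also have "(of_nat (Suc i) :: complex) gchoose i = of_nat (Suc i)"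
      by (simp flip: binomial_gbinomial del: of_nat_Suc)
    finally show ?thesis by (simp add: c_def power_mult_distrib[symmetric] flip: mult.assoc)
  qed
  have "mode V v (-2) (vac V) = Lop V (-1) v"
    using V.L_derivative[of v "-1" "vac V"] V.creation_lim[of "Lop V (-1) v"] by simp
  then have "mode W (Lop V (-1) v) p w = mode W (mode V v (-2 + int 0) (vac V)) (0 + p - int 0) w"
    by simp
  also have "\<dots> = Sum_any (\<lambda>i::nat. smul W (of_int 0 gchoose i)
          (mode W (mode V v (-2 + int i) (vac V)) (0 + p - int i) w))"
    by (subst Sum_any_eq_lessThan[of 1]) (auto simp: gbinomial_0_left)
  also have "\<dots> = Sum_any (\<lambda>i::nat. smul W (c i)
      (mode W v (0 + -2 - int i) (mode W (vac V) (p + int i) w)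
          - smul W ((-1) powi (-2)) (mode W (vac V) (p + -2 - int i) (mode W v (0 + int i) w))))"
    unfolding c_def by (rule jacobi[symmetric])
  \<comment> \<open>The vacuum has only the mode \<open>-1\<close>. It meets the first product at \<open>i = -p-1\<close> if \<open>p < 0\<close>
    and the second one at \<open>i = p-1\<close> if \<open>p > 0\<close>; for \<open>p = 0\<close> both sides vanish.\<close>
  also have "\<dots> = Sum_any (\<lambda>i::nat. if i = nat (if p < 0 then - p - 1 else p - 1)
      then smul W (- of_int p) (mode W v (p - 1) w) else 0)"
  proof (rule Sum_any.cong)
    fix i :: nat
    have "(- 1 :: complex) powi (-2) = 1" by (simp add: power_int_def)
    then show "smul W (c i) (mode W v (0 + -2 - int i) (mode W (vac V) (p + int i) w)
          - smul W ((-1) powi (-2)) (mode W (vac V) (p + -2 - int i) (mode W v (0 + int i) w)))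
       = (if i = nat (if p < 0 then - p - 1 else p - 1)
      then smul W (- of_int p) (mode W v (p - 1) w) else 0)"
    proof (cases "p = 0")
      case False
      consider "p < 0" "i = nat (- p - 1)" | "p < 0" "i \<noteq> nat (- p - 1)" | "p > 0" "i = nat (p - 1)"
        | "p > 0" "i \<noteq> nat (p - 1)" using False by linarith
      then show ?thesis
      proof cases
        case 1
        then have "- int i = p + 1" by simp
        then have "0 + -2 - int i = p - 1" "c i = - of_int p" "p + int i = -1" "p + -2 - int i \<noteq> -1"
          unfolding c using 1 by auto
        then show ?thesis using 1 by (simp only: vacuum) simp
      next
        case 2
        then have "p + int i \<noteq> -1" "p + -2 - int i \<noteq> -1" by auto
        then show ?thesis using 2 by (simp add: vacuum mode.zero)
      next
        case 3
        then have "int i = p - 1" by simp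
        then have "0 + int i = p - 1" "c i = of_int p" "p + int i \<noteq> -1" "p + -2 - int i = -1"
          unfolding c using 3 by auto
        then show ?thesis using 3 \<open>(- 1 :: complex) powi (-2) = 1\<close> by (simp only: vacuum mode.zero) simp
      next
        case 4
        then have "p + int i \<noteq> -1" "p + -2 - int i \<noteq> -1" by auto
        then show ?thesis using 4 by (simp add: vacuum mode.zero)
      qed
    qed (simp add: vacuum mode.zero)
  qed
  also have "\<dots> = smul W (- of_int p) (mode W v (p - 1) w)" by simp
  finally show ?thesis .
qed

lemma res_Y_derivative: "res_Y W f (Lop V (-1) v) w = - res_Y W (fls_deriv f) v w"
proof -
  obtain a where a: "ord_ge a f" using ord_ge_exists by blast
  have "res_Y W (1 * f) (Lop V (-1) v) w = smul W (-1) (res_Y W (1 * (fls_deriv ^^ 1) f) v w)"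
  proof (rule cont_fun_eq[OF cont_fun_res cont_fun_scale[OF cont_fun_res_deriv] _ a])
    fix k
    show "res_Y W (1 * xmon k 0) (Lop V (-1) v) w = smul W (-1)
        (res_Y W (1 * (fls_deriv ^^ 1) (xmon k 0)) v w)"
      by (simp add: res_Y_monom mode_derivative fls_deriv_xmon res_Y_scale_kernel)
  qed
  then show ?thesis by simp
qed

definition Lsum :: "'v \<Rightarrow> 'v" where "Lsum v = Lop V (-1) v + Lop V 0 v"

text \<open>
  Integration by parts: \<open>L(-1)\<close> differentiates \<open>Y(v,x)\<close> and raises the weight by one, and \<open>L(0)\<close>
  cancels the derivative of the weight factor.
\<close>

lemma wres_Lsum: "wres V W g (Lsum v) w = - wres V W (fls_deriv (xmon 0 1 * g)) v w"
proof (induction v rule: V.homogeneous_induct)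
  case (homogeneous k v)
  have L0: "Lop V 0 v = smul V (of_int k) v" using homogeneous by (simp add: wt_space_def)
  have g: "g * xmon 0 (k + 1) = xmon 0 1 * g * xmon 0 k"
    using xmon_mult[of 0 1 0 k] by (simp add: ac_simps)
  have "wres V W g (Lsum v) w = - res_Y W (fls_deriv (xmon 0 1 * g * xmon 0 k)) v w
     + smul W (of_int k) (res_Y W (g * xmon 0 k) v w)"
    unfolding Lsum_def L0 wres_add_state wres_scale_state
        wres_homogeneous[OF V.Lop_minus_1_weight[OF homogeneous]]
      wres_homogeneous[OF homogeneous] res_Y_derivative g ..
  also have "fls_deriv (xmon 0 1 * g * xmon 0 k) = fls_deriv (xmon 0 1 * g) * xmon 0 k + fls_const
      (of_int k) * (g * xmon 0 k)"
  proof -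
    have "xmon 0 1 * g * fls_deriv (xmon 0 k) = fls_const (of_int k) *
        (g * (xmon 0 1 * xmon 0 (k - 1)))"
      unfolding fls_deriv_xmon by (simp add: ac_simps)
    then show ?thesis by (subst fls_deriv_mult) (simp add: xmon_mult del: fls_deriv_mult)
  qed
  finally show ?case
    by (simp add: res_Y_add_kernel res_Y_scale_kernel wres_homogeneous[OF homogeneous]
        del: fls_deriv_mult)
next
  case (add u v)
  have "Lsum (u + v) = Lsum u + Lsum v" by (simp add: Lsum_def Lop_def V.mode.add)
  then show ?case using add by (simp add: wres_add_state)
qed

lemma O'_zero: "0 \<in> O' V W n"
  and O'_add: "x \<in> O' V W n \<Longrightarrow> y \<in> O' V W n \<Longrightarrow> x + y \<in> O' V W n"
  and O'_scale: "x \<in> O' V W n \<Longrightarrow> smul W c x \<in> O' V W n"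
  and O'_diff: "x \<in> O' V W n \<Longrightarrow> y \<in> O' V W n \<Longrightarrow> x - y \<in> O' V W n"
  and O'_minus: "x \<in> O' V W n \<Longrightarrow> - x \<in> O' V W n"
  and O'_sum: "(\<And>i. i \<in> A \<Longrightarrow> f i \<in> O' V W n) \<Longrightarrow> sum f A \<in> O' V W n"
  unfolding O'_def by (blast intro: W.span_zero W.span_add W.span_scale W.span_diff W.span_neg W.span_sum)+

text \<open>
  Downward induction on \<open>a\<close>: by \<open>wres_Lsum\<close>, the kernel \<open>x^a (1+x)^n\<close> at \<open>(L(-1)+L(0))v\<close> is a
  combination of the kernels \<open>x^(a-1) (1+x)^n\<close>, with the nonzero coefficient \<open>-a\<close>, and \<open>x^a (1+x)^n\<close>
  at \<open>v\<close>.
\<close>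

lemma wres_xmon_O': "a \<le> - 2 * int n - 2 \<Longrightarrow> wres V W (xmon a (int n)) v w \<in> O' V W n"
proof (induction a arbitrary: v w rule: int_le_induct)
  case base
  show ?case
  proof (induction v rule: V.homogeneous_induct)
    case (homogeneous k v)
    have "xmon (- 2 * int n - 2) (int n) * xmon 0 k = fls_X powi (- 2 * int n - 2)
        * (1 + fls_X) powi (k + int n)"
      unfolding xmon_mult by (simp add: xmon_def add.commute)
    then have "wres V W (xmon (- 2 * int n - 2) (int n)) v w \<in> O'_gens V W n"
      unfolding wres_homogeneous[OF homogeneous] O'_gens_def using homogeneous by auto
    then show ?case unfolding O'_def by (rule W.span_base)
  qed (simp add: wres_add_state O'_add)
next
  case (step a)
  have "fls_deriv (xmon 0 1 * xmon a (int n)) = fls_const (of_int a) * xmon (a - 1) (int n)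
     + fls_const (of_int a + of_nat n + 1) * xmon a (int n)"
  proof -
    have "fls_deriv (xmon 0 1 * xmon a (int n)) = fls_const (of_int a) * xmon (a - 1) (int n + 1)
       + fls_const (of_nat n + 1) * xmon a (int n)"
      unfolding xmon_mult fls_deriv_xmon by (simp add: add.commute)
    then show ?thesis using xmon_split[of "a - 1" "int n"]
      by (simp add: distrib_left distrib_right flip: fls_plus_const)
  qed
  then have "smul W (of_int a) (wres V W (xmon (a - 1) (int n)) v w)
    = - wres V W (xmon a (int n)) (Lsum v) w - smul W (of_int a + of_nat n + 1)
        (wres V W (xmon a (int n)) v w)"
    unfolding wres_Lsum by (simp add: wres_add_kernel wres_scale_kernel)
  also have "\<dots> \<in> O' V W n" using step by (intro O'_diff O'_minus O'_scale) auto
  finally have "smul W (inverse (of_int a))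
      (smul W (of_int a) (wres V W (xmon (a - 1) (int n)) v w)) \<in> O' V W n"
    by (rule O'_scale)
  then show ?case using step.hyps by simp
qed

lemma wres_tail_kernels: "f \<in> tail_kernels n \<Longrightarrow> wres V W f v w \<in> O' V W n"
proof (induction f rule: tail_kernels.induct)
  case tail_kernels_zero
  show ?case by (simp add: kernel.zero O'_zero)
next
  case (tail_kernels_add f a c)
  then show ?case by (simp add: wres_add_kernel wres_scale_kernel O'_add O'_scale wres_xmon_O')
qed

lemma O'_induct [consumes 1, case_names add kernel]:
  assumes "x \<in> O' V W n"
    and "\<And>x y. P x \<Longrightarrow> P y \<Longrightarrow> P (x + y)"
    and "\<And>v w. P (wres V W (xmon (- 2 * int n - 2) (int n)) v w)"
  shows "P x"
  using assms(1) unfolding O'_def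
proof (induction rule: W.span_induct_alt)
  case base
  show ?case using assms(3)[of 0 0] by (simp add: wstate.zero)
next
  case (step c x y)
  then obtain k v w where v: "v \<in> wt_space V k"
    and x: "x = res_Y W (fls_X powi (- 2 * int n - 2) * (1 + fls_X) powi (k + int n)) v w"
    unfolding O'_gens_def by auto
  have "xmon (- 2 * int n - 2) (int n) * xmon 0 k = fls_X powi (- 2 * int n - 2) * (1 + fls_X) powi
      (k + int n)"
    unfolding xmon_mult by (simp add: xmon_def add.commute)
  then have "smul W c x = wres V W (xmon (- 2 * int n - 2) (int n)) v (smul W c w)"
    unfolding wres_homogeneous[OF v] by (simp add: x res_Y_scale)
  then show ?case using assms(2)[OF assms(3)[of v "smul W c w"] step(2)] by simp
qed

lemma res_Y_xmon: "\<forall>\<^sub>F I in sequentially.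
   res_Y W (xmon a c) v w = (\<Sum>i<I. smul W (of_int c gchoose i) (mode W v (a + int i) w))"
proof -
  obtain N where N: "\<forall>m\<ge>N. mode W v m w = 0" using truncation by blast
  show ?thesis unfolding eventually_sequentially
  proof (intro exI[of _ "nat (N - a)"] allI impI)
    fix I assume I: "nat (N - a) \<le> I"
    let ?f = "\<lambda>k. smul W (fls_nth (xmon a c) k) (mode W v k w)"
    have "res_Y W (xmon a c) v w = sum ?f ((\<lambda>i. a + int i) ` {..<I})"
      unfolding res_Y_def
    proof (rule Sum_any.expand_superset, simp, rule subsetI)
      fix k assume k: "k \<in> {k. ?f k \<noteq> 0}"
      then have "k \<ge> a" "k < N" using N by (auto simp: xmon_nth not_le[symmetric] split: if_splits)
      then have "k = a + int (nat (k - a))" "nat (k - a) < I" using I by auto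
      then show "k \<in> (\<lambda>i. a + int i) ` {..<I}" by blast
    qed
    also have "\<dots> = (\<Sum>i<I. smul W (of_int c gchoose i) (mode W v (a + int i) w))"
      by (subst sum.reindex) (auto simp: inj_on_def xmon_nth)
    finally show "res_Y W (xmon a c) v w = \<dots>" .
  qed
qed

lemma wres_eventually_zero: "\<forall>\<^sub>F I in sequentially. \<forall>p\<ge>int I. wres V W (xmon p c) u w = 0"
proof (induction u rule: V.homogeneous_induct)
  case (homogeneous k u)
  obtain N where N: "\<forall>m\<ge>N. mode W u m w = 0" using truncation by blast
  have "wres V W (xmon p c) u w = 0" if "p \<ge> N" for p
    unfolding wres_homogeneous[OF homogeneous] xmon_mult using that N
    by (intro res_Y_eq_0) (auto simp: xmon_nth split: if_splits)
  then show ?case unfolding eventually_sequentially by (intro exI[of _ "nat N"]) auto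
next
  case (add u u')
  then show ?case by eventually_elim (simp add: wres_add_state)
qed

lemma jacobi_res:
  "\<forall>\<^sub>F I in sequentially.
    (\<Sum>i<I. smul W ((-1) ^ i * (of_int l gchoose i))
       (res_Y W (xmon (l - int i) 0 * g) u (res_Y W (xmon (int i) 0 * h) v w)
        - smul W ((-1) powi l) (res_Y W (xmon (l - int i) 0 * h) v (res_Y W (xmon (int i) 0 * g) u w))))
     = (\<Sum>i<I. smul W (1 / fact i) (res_Y W (h * (fls_deriv ^^ i) g) (mode V u (l + int i) v) w))"
proof -
  obtain a where a: "ord_ge a g" using ord_ge_exists by blast
  obtain b where b: "ord_ge b h" using ord_ge_exists by blast
  obtain N1 where N1: "\<forall>m\<ge>N1. mode W u m w = 0" using truncation by blast
  obtain N2 where N2: "\<forall>m\<ge>N2. mode W v m w = 0" using truncation by blast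
  obtain N3 where N3: "\<forall>m\<ge>N3. mode V u m v = 0" using V.truncation by blast
  show ?thesis
    unfolding eventually_sequentially
  proof (intro exI[of _ "max (nat (N1 - a)) (max (nat (N2 - b)) (nat (N3 - l)))"] allI impI,
      rule jacobi_res_bound[OF a b])
  qed (use N1 N2 N3 in auto)
qed

end

context voa
begin

text \<open>
  The algebra \<open>A\<^sub>n(V)\<close> is treated through the adjoint module.
\<close>

sublocale adj: voa_module V V by unfold_locales

end

section \<open>Residues of products\<close>

context voa_module
begin

text \<open>
  The \<open>i\<close>-th terms in the two expansions of the test function
  \<open>(x\<^sub>1-x\<^sub>2)^j (1+x\<^sub>1)^c (1+x\<^sub>2)^(-c-j-1) h(x\<^sub>2)\<close>, weight factors omitted.
\<close>

definition jacobi_term :: "int \<Rightarrow> int \<Rightarrow> complex fls \<Rightarrow> 'v \<Rightarrow> 'v \<Rightarrow> 'w \<Rightarrow> nat \<Rightarrow> 'w" where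
  "jacobi_term j c h u v w i = smul W ((-1) ^ i * (of_int j gchoose i))
     (wres V W (xmon (j - int i) c) u (wres V W (h * xmon (int i) (- c - j - 1)) v w)
      - smul W ((-1) powi j) (wres V W (h * xmon (j - int i) (- c - j - 1)) v
          (wres V W (xmon (int i) c) u w)))"

text \<open>
  The substitution \<open>x\<^sub>1 = x\<^sub>2 + (1+x\<^sub>2) y\<close> gives \<open>y = (x\<^sub>1-x\<^sub>2)/(1+x\<^sub>2)\<close> and
  \<open>1+y = (1+x\<^sub>1)/(1+x\<^sub>2)\<close>. It takes the kernel \<open>y^j (1+y)^c\<close> for \<open>u\<close> and \<open>h(x\<^sub>2)\<close> for the product,
  with their weight factors, to the test function of \<open>jacobi_term\<close> with the weight factors of \<open>u\<close>
  and \<open>v\<close>; the exponent \<open>-1\<close> of \<open>1+x\<^sub>2\<close> arises because the weight of \<open>u\<^sub>m v\<close> is \<open>wt u + wt v - m - 1\<close>.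
\<close>

lemma wres_product_homogeneous:
  assumes u: "u \<in> wt_space V k" and v: "v \<in> wt_space V l"
  shows "\<forall>\<^sub>F I in sequentially. wres V W h (wres V V (xmon j c) u v) w
      = (\<Sum>i<I. jacobi_term j c h u v w i)"
proof -
  let ?h = "h * xmon 0 (l - c - j - 1)"
  have J: "smul W ((-1) ^ i * (of_int j gchoose i))
       (res_Y W (xmon (j - int i) 0 * xmon 0 (c + k)) u (res_Y W (xmon (int i) 0 * ?h) v w)
        - smul W ((-1) powi j) (res_Y W (xmon (j - int i) 0 * ?h) v
            (res_Y W (xmon (int i) 0 * xmon 0 (c + k)) u w)))
     = jacobi_term j c h u v w i" for i
  proof -
    have x: "xmon p 0 * xmon 0 (c + k) = xmon p c * xmon 0 k" for p by (simp add: xmon_mult)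
    have y: "xmon p 0 * ?h = h * xmon p (- c - j - 1) * xmon 0 l" for p
      by (simp only: mult.left_commute[of "xmon p 0"] mult.assoc xmon_mult) (simp add: algebra_simps)
    show ?thesis
      unfolding jacobi_term_def x y wres_homogeneous[OF u] wres_homogeneous[OF v] ..
  qed
  have R: "smul W (1 / fact i) (res_Y W (?h * (fls_deriv ^^ i) (xmon 0 (c + k)))
      (mode V u (j + int i) v) w)
     = smul W (of_int (c + k) gchoose i) (wres V W h (mode V u (j + int i) v) w)" for i
  proof -
    have x: "?h * (fls_const d * xmon 0 (c + k - int i)) = fls_const d *
        (h * xmon 0 (k + l - (j + int i) - 1))" for d
      by (simp only: mult.assoc mult.left_commute[of _ "fls_const d"] xmon_mult)
          (simp add: algebra_simps)
    show ?thesis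
      unfolding higher_deriv_xmon_0 x res_Y_scale_kernel wres_homogeneous[OF V.mode_weight[OF u v]]
      by simp
  qed
  have "\<forall>\<^sub>F I in sequentially. res_Y V (xmon j (c + k)) u v
      = (\<Sum>i<I. smul V (of_int (c + k) gchoose i) (mode V u (j + int i) v))"
    by (rule V.adj.res_Y_xmon)
  moreover have "wres V V (xmon j c) u v = res_Y V (xmon j (c + k)) u v"
    by (simp add: V.adj.wres_homogeneous[OF u] xmon_mult)
  ultimately have "\<forall>\<^sub>F I in sequentially. wres V W h (wres V V (xmon j c) u v) w
     = (\<Sum>i<I. smul W (of_int (c + k) gchoose i) (wres V W h (mode V u (j + int i) v) w))"
    by (auto elim!: eventually_mono simp: wstate.sum wres_scale_state)
  with jacobi_res[of j "xmon 0 (c + k)" u ?h v w] show ?thesis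
    unfolding J R by eventually_elim simp
qed

lemma jacobi_term_add_left: "jacobi_term j c h (u + u') v w i = jacobi_term j c h u v w i
    + jacobi_term j c h u' v w i"
  by (simp add: jacobi_term_def wres_add_state
      wres_add W.scale_right_distrib W.scale_right_diff_distrib)

lemma jacobi_term_add_right: "jacobi_term j c h u (v + v') w i = jacobi_term j c h u v w i
    + jacobi_term j c h u v' w i"
  by (simp add: jacobi_term_def wres_add_state
      wres_add W.scale_right_distrib W.scale_right_diff_distrib)

text \<open>
  The terms are biadditive in \<open>u\<close> and \<open>v\<close>, and finitely many statements that hold for all large \<open>I\<close>
  hold simultaneously.
\<close>

lemma wres_product:
  "\<forall>\<^sub>F I in sequentially. wres V W h (wres V V (xmon j c) u v) w = (\<Sum>i<I. jacobi_term j c h u v w i)"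
proof (induction u arbitrary: v rule: V.homogeneous_induct)
  case (homogeneous k u)
  show ?case
  proof (induction v rule: V.homogeneous_induct)
    case (homogeneous l v)
    show ?case by (rule wres_product_homogeneous) fact+
  next
    case (add v v')
    then show ?case
      by eventually_elim (simp add: V.adj.wres_add wres_add_state jacobi_term_add_right sum.distrib)
  qed
next
  case (add u u')
  from add.IH[of v] show ?case
    by eventually_elim (simp add: V.adj.wres_add_state wres_add_state jacobi_term_add_left sum.distrib)
qed

text \<open>
  For \<open>j = 0\<close> and \<open>c = -1\<close> the test function is \<open>(1+x\<^sub>1)^(-1) h(x\<^sub>2)\<close>, and one term remains.
\<close>

lemma comm_derivation:
  "wres V W h (wres V V (xmon 0 (-1)) u v) w
     = wres V W (xmon 0 (-1)) u (wres V W h v w) - wres V W h v (wres V W (xmon 0 (-1)) u w)"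
proof -
  have "\<forall>\<^sub>F I in sequentially. wres V W h (wres V V (xmon 0 (-1)) u v) w = jacobi_term 0 (-1) h u v w 0"
    using wres_product[of h 0 "-1" u v w] eventually_ge_at_top[of 1]
  proof eventually_elim
    case (elim I)
    have "(\<Sum>i<I. jacobi_term 0 (-1) h u v w i)
        = (\<Sum>i<I. if i = 0 then jacobi_term 0 (-1) h u v w 0 else 0)"
      by (rule sum.cong) (auto simp: jacobi_term_def gbinomial_0_left)
    also have "\<dots> = jacobi_term 0 (-1) h u v w 0" using elim by simp
    finally show ?case using elim by simp
  qed
  then show ?thesis by (simp add: jacobi_term_def)
qed

text \<open>
  The half of the Jacobi identity in which \<open>u\<close> acts last. The terms with \<open>m + i > n\<close> lie in \<open>O'\<close>;
  the others, collected by \<open>s = m + i\<close>, are evaluated with \<open>lkernel_reexpansion\<close>.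
\<close>

lemma lact_expand_left:
  assumes "I > n"
  shows "(\<Sum>m=0..n. \<Sum>i<I. smul W (act_coeff n m * ((-1) ^ i * (of_int (- int n - int m - 1) gchoose i)))
      (wres V W (xmon (- int n - int m - 1 - int i) (int n)) u
          (wres V W (h * xmon (int i) (int m)) v w)))
    - wres V W (lkernel n) u (wres V W h v w) \<in> O' V W n"
proof -
  define e where "e m i = smul W (act_coeff n m * ((-1) ^ i * (of_int (- int n - int m - 1) gchoose i)))
      (wres V W (xmon (- int n - int m - 1 - int i) (int n)) u
          (wres V W (h * xmon (int i) (int m)) v w))" for m i
  define A where "A = {0..n} \<times> {..<I}"
  define B where "B = {(m, i). m + i \<le> n}"
  have B: "B \<subseteq> A" using assms by (auto simp: A_def B_def)
  have "(\<Sum>m=0..n. \<Sum>i<I. e m i) = (\<Sum>(m, i)\<in>A. e m i)"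
    by (simp add: A_def sum.cartesian_product)
  also have "\<dots> = (\<Sum>(m, i)\<in>A - B. e m i) + (\<Sum>(m, i)\<in>B. e m i)"
    by (rule sum.subset_diff[OF B]) (simp add: A_def)
  also have "(\<Sum>(m, i)\<in>B. e m i) = (\<Sum>s\<le>n. \<Sum>m\<le>s. e m (s - m))"
    unfolding B_def by (rule sum.triangle_reindex_eq)
  also have "\<dots> = (\<Sum>s\<le>n. smul W (act_coeff n s)
      (wres V W (xmon (- int n - int s - 1) (int n)) u (wres V W h v w)))"
  proof (rule sum.cong[OF refl])
    fix s assume "s \<in> {..n}"
    have "(\<Sum>m\<le>s. e m (s - m)) = (\<Sum>m\<le>s. wres V W (xmon (- int n - int s - 1) (int n)) u
       (wres V W (h * (fls_const (act_coeff n m *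
           ((-1) ^ (s - m) * (of_int (- int n - int m - 1) gchoose (s - m)))) * xmon (int (s - m))
            (int m))) v w))"
    proof (rule sum.cong[OF refl])
      fix m assume "m \<in> {..s}"
      then have "- int n - int m - 1 - int (s - m) = - int n - int s - 1" by auto
      then show "e m (s - m) = wres V W (xmon (- int n - int s - 1) (int n)) u
       (wres V W (h * (fls_const (act_coeff n m *
           ((-1) ^ (s - m) * (of_int (- int n - int m - 1) gchoose (s - m)))) * xmon (int (s - m))
            (int m))) v w)"
        by (simp only: e_def mult.left_commute[of h] wres_scale_kernel wres_scale)
    qed
    also have "\<dots> = wres V W (xmon (- int n - int s - 1) (int n)) u
        (wres V W (h * fls_const (act_coeff n s)) v w)"
      by (simp only: wvec.sum[symmetric] kernel.sum[symmetric] sum_distrib_left[symmetric] lkernel_reexpansion)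
    also have "\<dots> = smul W (act_coeff n s)
        (wres V W (xmon (- int n - int s - 1) (int n)) u (wres V W h v w))"
      by (simp only: mult.commute[of h] wres_scale_kernel wres_scale)
    finally show "(\<Sum>m\<le>s. e m (s - m)) = \<dots>" .
  qed
  also have "\<dots> = wres V W (lkernel n) u (wres V W h v w)"
    by (simp only: lkernel_def kernel.sum wres_scale_kernel atLeast0AtMost)
  finally have "(\<Sum>m=0..n. \<Sum>i<I. e m i) - wres V W (lkernel n) u (wres V W h v w)
      = (\<Sum>(m, i)\<in>A - B. e m i)"
    by simp
  also have "\<dots> \<in> O' V W n"
  proof (rule O'_sum)
    fix x assume "x \<in> A - B"
    then obtain m i where x: "x = (m, i)" "m + i > n" by (cases x) (auto simp: A_def B_def)
    then have "- int n - int m - 1 - int i \<le> - 2 * int n - 2" by linarith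
    then show "(case x of (m, i) \<Rightarrow> e m i) \<in> O' V W n"
      unfolding x e_def by (simp add: O'_scale wres_xmon_O')
  qed
  finally show ?thesis unfolding e_def .
qed

text \<open>
  For every outer kernel \<open>h\<close>, the first half of the product formula is composition with the left
  action of \<open>u\<close>, modulo \<open>O'\<close>; the displayed sum is the second half.
\<close>

lemma lact_product:
  "\<forall>\<^sub>F I in sequentially. wres V W h (wres V V (lkernel n) u v) w - wres V W (lkernel n) u
      (wres V W h v w)
    - (\<Sum>m=0..n. \<Sum>i<I. smul W (act_coeff n m * (-1) ^ (n + m) *
        ((-1) ^ i * (of_int (- int n - int m - 1) gchoose i)))
        (wres V W (h * xmon (- int n - int m - 1 - int i) (int m)) v
            (wres V W (xmon (int i) (int n)) u w))) \<in> O' V W n"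
proof -
  have "\<forall>\<^sub>F I in sequentially. \<forall>m\<in>{0..n}. wres V W h
      (wres V V (xmon (- int n - int m - 1) (int n)) u v) w
      = (\<Sum>i<I. jacobi_term (- int n - int m - 1) (int n) h u v w i)"
    by (simp add: eventually_ball_finite wres_product)
  then show ?thesis using eventually_gt_at_top[of n]
  proof eventually_elim
    case (elim I)
    have "wres V W h (wres V V (lkernel n) u v) w
      = (\<Sum>m=0..n. smul W (act_coeff n m)
          (wres V W h (wres V V (xmon (- int n - int m - 1) (int n)) u v) w))"
      by (simp only: lkernel_def V.adj.kernel.sum V.adj.wres_scale_kernel wstate.sum wres_scale_state)
    also have "\<dots> = (\<Sum>m=0..n. smul W (act_coeff n m) (\<Sum>i<I. jacobi_term (- int n - int m - 1)
        (int n) h u v w i))"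
      using elim(1) by (intro sum.cong) auto
    also have "\<dots> = (\<Sum>m=0..n. \<Sum>i<I. smul W
        (act_coeff n m * ((-1) ^ i * (of_int (- int n - int m - 1) gchoose i)))
      (wres V W (xmon (- int n - int m - 1 - int i) (int n)) u
          (wres V W (h * xmon (int i) (int m)) v w)))
     + (\<Sum>m=0..n. \<Sum>i<I. smul W (act_coeff n m * (-1) ^ (n + m) *
         ((-1) ^ i * (of_int (- int n - int m - 1) gchoose i)))
        (wres V W (h * xmon (- int n - int m - 1 - int i) (int m)) v
            (wres V W (xmon (int i) (int n)) u w)))"
      unfolding sum.distrib[symmetric] W.scale_sum_right
    proof (intro sum.cong refl)
      fix m i
      have x: "- int n - (- int n - int m - 1) - 1 = int m" by simp
      have s: "(-1 :: complex) powi (- int n - int m - 1) = - ((-1) ^ (n + m))"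
      proof -
        have e: "- int n - int m - 1 = - int (n + m + 1)" by simp
        show ?thesis unfolding e power_int_minus power_int_of_nat by (simp add: minus_one_power_iff)
      qed
      show "smul W (act_coeff n m) (jacobi_term (- int n - int m - 1) (int n) h u v w i)
        = smul W (act_coeff n m * ((-1) ^ i * (of_int (- int n - int m - 1) gchoose i)))
      (wres V W (xmon (- int n - int m - 1 - int i) (int n)) u
          (wres V W (h * xmon (int i) (int m)) v w))
      + smul W (act_coeff n m * (-1) ^ (n + m) * ((-1) ^ i * (of_int (- int n - int m - 1) gchoose i)))
        (wres V W (h * xmon (- int n - int m - 1 - int i) (int m)) v
            (wres V W (xmon (int i) (int n)) u w))"
        unfolding jacobi_term_def x s
        by (simp only: W.scale_scale W.scale_right_diff_distrib W.scale_minus_left diff_minus_eq_add W.scale_right_distrib)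
          (simp only: ac_simps)
    qed
    finally show ?case using lact_expand_left[OF elim(2), of u h v w] by (simp add: algebra_simps)
  qed
qed

section \<open>Left action and stability of O'\<close>

text \<open>
  For \<open>h = x^a (1+x)^n\<close> with \<open>a \<le> -n-1\<close>, every kernel for \<open>v\<close> in the second half of \<open>lact_product\<close> is
  a tail kernel. This covers the summands of \<open>lkernel n\<close> as well as the kernel that generates
  \<open>O'\<close>.
\<close>

lemma lact_xmon_assoc:
  assumes "a \<le> - int n - 1"
  shows "wres V W (xmon a (int n)) (wres V V (lkernel n) u v) w
     - wres V W (lkernel n) u (wres V W (xmon a (int n)) v w) \<in> O' V W n"
proof -
  have t: "xmon a (int n) * xmon (- int n - int m - 1 - int i) (int m) \<in> tail_kernels n" for m i
    unfolding xmon_mult using assms by (intro tail_kernels_xmon_ge) auto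
  obtain I where I: "wres V W (xmon a (int n)) (wres V V (lkernel n) u v) w - wres V W (lkernel n) u
      (wres V W (xmon a (int n)) v w)
    - (\<Sum>m=0..n. \<Sum>i<I. smul W (act_coeff n m * (-1) ^ (n + m) *
        ((-1) ^ i * (of_int (- int n - int m - 1) gchoose i)))
        (wres V W (xmon a (int n) * xmon (- int n - int m - 1 - int i) (int m)) v
            (wres V W (xmon (int i) (int n)) u w))) \<in> O' V W n"
    using eventually_happens'[OF sequentially_bot lact_product[of "xmon a (int n)" n u v w]] by blast
  have "(\<Sum>m=0..n. \<Sum>i<I. smul W (act_coeff n m * (-1) ^ (n + m) *
      ((-1) ^ i * (of_int (- int n - int m - 1) gchoose i)))
        (wres V W (xmon a (int n) * xmon (- int n - int m - 1 - int i) (int m)) v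
            (wres V W (xmon (int i) (int n)) u w))) \<in> O' V W n"
    by (intro O'_sum O'_scale wres_tail_kernels t)
  from O'_add[OF I this] show ?thesis by simp
qed

lemma lact_assoc:
  "wres V W (lkernel n) (wres V V (lkernel n) u v) w - wres V W (lkernel n) u
      (wres V W (lkernel n) v w) \<in> O' V W n"
proof -
  have "wres V W (lkernel n) (wres V V (lkernel n) u v) w - wres V W (lkernel n) u
      (wres V W (lkernel n) v w)
     = (\<Sum>m=0..n. smul W (act_coeff n m) (wres V W (xmon (- int n - int m - 1) (int n))
         (wres V V (lkernel n) u v) w
     - wres V W (lkernel n) u (wres V W (xmon (- int n - int m - 1) (int n)) v w)))"
    by (simp only: wres_lkernel[of n _ w] wres_lkernel[of n v w] wvec.sum
        wres_scale W.scale_right_diff_distrib sum_subtractf)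
  also have "\<dots> \<in> O' V W n"
    by (intro O'_sum O'_scale lact_xmon_assoc) simp
  finally show ?thesis .
qed

lemma lact_O':
  assumes "x \<in> O' V W n"
  shows "wres V W (lkernel n) u x \<in> O' V W n"
  using assms
proof (induction rule: O'_induct)
  case (add x y)
  then show ?case by (simp add: wres_add O'_add)
next
  case (kernel v w)
  have "wres V W (xmon (- 2 * int n - 2) (int n)) (wres V V (lkernel n) u v) w \<in> O' V W n"
    by (rule wres_xmon_O') simp
  from O'_diff[OF this lact_xmon_assoc[of "- 2 * int n - 2" n u v w]] show ?case by simp
qed

text \<open>
  A derivation maps a residue with a given kernel to residues with the same kernel.
\<close>

lemma comm_O':
  assumes "x \<in> O' V W n"
  shows "wres V W (xmon 0 (-1)) u x \<in> O' V W n"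
  using assms
proof (induction rule: O'_induct)
  case (add x y)
  then show ?case by (simp add: wres_add O'_add)
next
  case (kernel v w)
  have "wres V W (xmon 0 (-1)) u (wres V W (xmon (- 2 * int n - 2) (int n)) v w)
     = wres V W (xmon (- 2 * int n - 2) (int n)) (wres V V (xmon 0 (-1)) u v) w
       + wres V W (xmon (- 2 * int n - 2) (int n)) v (wres V W (xmon 0 (-1)) u w)"
    by (simp add: comm_derivation)
  then show ?case by (simp add: O'_add wres_xmon_O')
qed

lemma ract_O': "x \<in> O' V W n \<Longrightarrow> wres V W (rkernel n) u x \<in> O' V W n"
  unfolding rkernel_eq by (intro O'_diff lact_O' comm_O')

text \<open>
  If the inner kernel is a tail kernel, both halves of the product formula are in \<open>O'\<close>: the
  first because of the kernels for \<open>u\<close>, the second by assumption.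
\<close>

lemma wres_tail_kernels_product:
  assumes a: "a \<le> - 2 * int n - 2" and t: "\<And>i. h * xmon (a - int i) (- int n - a - 1) \<in> tail_kernels n"
  shows "wres V W h (wres V V (xmon a (int n)) u v) w \<in> O' V W n"
proof -
  obtain I where "wres V W h (wres V V (xmon a (int n)) u v) w
      = (\<Sum>i<I. jacobi_term a (int n) h u v w i)"
    using eventually_happens'[OF sequentially_bot wres_product] by blast
  also have "\<dots> \<in> O' V W n"
    unfolding jacobi_term_def using a
    by (intro O'_sum O'_scale O'_diff wres_tail_kernels[OF t] wres_xmon_O') simp
  finally show ?thesis .
qed

text \<open>
  The generating kernel \<open>a = -2n-2\<close> leaves the factor \<open>(1+x)^(n+1)\<close> for the second half, enough
  for the outer kernels \<open>x^(-n-m-1) (1+x)^n\<close> and also for \<open>(1+x)^(-1)\<close>.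
\<close>

lemma lact_left_O':
  assumes "x \<in> O' V V n"
  shows "wres V W (lkernel n) x w \<in> O' V W n" "wres V W (xmon 0 (-1)) x w \<in> O' V W n"
proof -
  show "wres V W (lkernel n) x w \<in> O' V W n"
    using assms
  proof (induction rule: V.adj.O'_induct)
    case (add x y)
    then show ?case by (simp add: wres_add_state O'_add)
  next
    case (kernel u v)
    have "xmon (- int n - int m - 1) (int n)
        * xmon (- 2 * int n - 2 - int i) (- int n - (- 2 * int n - 2) - 1) \<in> tail_kernels n" for m i
      unfolding xmon_mult by (intro tail_kernels_xmon_ge) auto
    then show ?case
      unfolding wres_lkernel by (intro O'_sum O'_scale wres_tail_kernels_product) auto
  qed
  show "wres V W (xmon 0 (-1)) x w \<in> O' V W n"
    using assms
  proof (induction rule: V.adj.O'_induct)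
    case (add x y)
    then show ?case by (simp add: wres_add_state O'_add)
  next
    case (kernel u v)
    have "xmon 0 (-1) * xmon (- 2 * int n - 2 - int i) (- int n - (- 2 * int n - 2) - 1)
        \<in> tail_kernels n" for i
      unfolding xmon_mult by (intro tail_kernels_xmon_ge) auto
    then show ?case by (intro wres_tail_kernels_product) auto
  qed
qed

lemma lact_Lsum: "wres V W (lkernel n) (Lsum v) w \<in> O' V W n"
  unfolding wres_Lsum deriv_lkernel by (intro O'_minus
      wres_tail_kernels tail_kernels_const tail_kernels_xmon) simp

lemma comm_Lsum: "wres V W (xmon 0 (-1)) (Lsum v) w = 0"
  unfolding wres_Lsum by (simp add: xmon_mult kernel.zero del: fls_deriv_mult)

section \<open>Right action\<close>

text \<open>
  The test function has no power of \<open>x\<^sub>1-x\<^sub>2\<close>, so the Jacobi identity is the commutator formula.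
  The \<open>i\<close>-th derivative of the kernel for \<open>v\<close> trades powers of \<open>1+x\<close> for negative powers of \<open>x\<close>; after
  taking out the weight factor of \<open>v\<^sub>i u\<close>, each product with \<open>x^a (1+x)^n\<close> is a tail kernel.
\<close>

lemma left_right_xmon_commute:
  assumes a: "a \<le> - int n - 1"
  shows "wres V W (xmon (- int n - int m - 1) (int m - 1)) v (wres V W (xmon a (int n)) u w)
    - wres V W (xmon a (int n)) u (wres V W (xmon (- int n - int m - 1) (int m - 1)) v w) \<in> O' V W n"
proof (induction v rule: V.homogeneous_induct)
  case (homogeneous k v)
  show ?case
  proof (induction u rule: V.homogeneous_induct)
    case (homogeneous l u)
    note v = \<open>v \<in> wt_space V k\<close> and u = homogeneous
    let ?g = "xmon (- int n - int m - 1) (int m - 1 + k)" and ?h = "xmon a (int n + l)"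
    have "\<forall>\<^sub>F I in sequentially. res_Y W ?g v (res_Y W ?h u w) - res_Y W ?h u (res_Y W ?g v w)
       = (\<Sum>i<I. smul W (1 / fact i) (res_Y W (?h * (fls_deriv ^^ i) ?g) (mode V v (0 + int i) u) w))"
      using jacobi_res[of 0 ?g v ?h u w] eventually_ge_at_top[of 1]
    proof eventually_elim
      case (elim I)
      have "res_Y W ?g v (res_Y W ?h u w) - res_Y W ?h u (res_Y W ?g v w)
        = (\<Sum>i<I. if i = 0 then res_Y W ?g v (res_Y W ?h u w) - res_Y W ?h u (res_Y W ?g v w) else 0)"
        using elim by simp
      also have "\<dots> = (\<Sum>i<I. smul W ((-1) ^ i * (of_int 0 gchoose i))
       (res_Y W (xmon (0 - int i) 0 * ?g) v (res_Y W (xmon (int i) 0 * ?h) u w)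
        - smul W ((-1) powi 0) (res_Y W (xmon (0 - int i) 0 * ?h) u
            (res_Y W (xmon (int i) 0 * ?g) v w))))"
        by (rule sum.cong) (auto simp: gbinomial_0_left)
      finally show ?case using elim by simp
    qed
    then obtain I where "res_Y W ?g v (res_Y W ?h u w) - res_Y W ?h u (res_Y W ?g v w)
       = (\<Sum>i<I. smul W (1 / fact i) (res_Y W (?h * (fls_deriv ^^ i) ?g) (mode V v (0 + int i) u) w))"
      using eventually_happens by fastforce
    also have "\<dots> \<in> O' V W n"
    proof (intro O'_sum O'_scale)
      fix i
      let ?x = "mode V v (0 + int i) u"
      have x: "?x \<in> wt_space V (k + l - (0 + int i) - 1)" by (rule V.mode_weight[OF v u])
      have "(fls_deriv ^^ i) ?g \<in> {f. res_Y W (?h * f) ?x w \<in> O' V W n}"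
      proof (rule higher_deriv_xmon_closed)
        fix s
        have "?h * xmon (- int n - int m - 1 - int s) (int m - 1 + k - int i + int s)
          = xmon (a - int n - int m - 1 - int s) (int n + int m + int s) * xmon 0
            (k + l - (0 + int i) - 1)"
          unfolding xmon_mult by (simp add: algebra_simps)
        then have "res_Y W (?h * xmon (- int n - int m - 1 - int s)
            (int m - 1 + k - int i + int s)) ?x w
           = wres V W (xmon (a - int n - int m - 1 - int s) (int n + int m + int s)) ?x w"
          by (simp only: wres_homogeneous[OF x])
        also have "\<dots> \<in> O' V W n"
          using a by (intro wres_tail_kernels tail_kernels_xmon_ge) auto
        finally show "xmon (- int n - int m - 1 - int s) (int m - 1 + k - int i + int s)
            \<in> {f. res_Y W (?h * f) ?x w \<in> O' V W n}"
          by simp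
      qed (simp_all add: distrib_left res_Y_add_kernel O'_add mult.left_commute[of ?h]
          res_Y_scale_kernel O'_scale)
      then show "res_Y W (?h * (fls_deriv ^^ i) ?g) ?x w \<in> O' V W n" by simp
    qed
    finally show ?case
      by (simp add: wres_homogeneous[OF u] wres_homogeneous[OF v] xmon_mult)
  next
    case (add u u')
    from O'_add[OF add] show ?case by (simp add: wres_add_state wres_add algebra_simps)
  qed
next
  case (add v v')
  from O'_add[OF add] show ?case by (simp add: wres_add_state wres_add algebra_simps)
qed

lemma left_right_commute:
  "wres V W (rkernel n) v (wres V W (lkernel n) u w) - wres V W (lkernel n) u
      (wres V W (rkernel n) v w) \<in> O' V W n"
proof -
  have r: "wres V W (rkernel n) v x = (\<Sum>m=0..n. smul W (act_coeff n m * (-1) ^ (n - m))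
      (wres V W (xmon (- int n - int m - 1) (int m - 1)) v x))" for x
    by (simp only: rkernel_def kernel.sum wres_scale_kernel)
  have "wres V W (rkernel n) v (wres V W (lkernel n) u w) - wres V W (lkernel n) u
      (wres V W (rkernel n) v w)
    = (\<Sum>m=0..n. smul W (act_coeff n m * (-1) ^ (n - m)) (
      wres V W (xmon (- int n - int m - 1) (int m - 1)) v (wres V W (lkernel n) u w)
    - wres V W (lkernel n) u (wres V W (xmon (- int n - int m - 1) (int m - 1)) v w)))"
    unfolding r by (simp only: wvec.sum wres_scale W.scale_right_diff_distrib sum_subtractf)
  also have "\<dots> = (\<Sum>m=0..n. smul W (act_coeff n m * (-1) ^ (n - m)) (\<Sum>p=0..n. smul W (act_coeff n p)
      (wres V W (xmon (- int n - int m - 1) (int m - 1)) v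
          (wres V W (xmon (- int n - int p - 1) (int n)) u w)
    - wres V W (xmon (- int n - int p - 1) (int n)) u
        (wres V W (xmon (- int n - int m - 1) (int m - 1)) v w))))"
    unfolding wres_lkernel by (simp only: wvec.sum wres_scale W.scale_right_diff_distrib sum_subtractf)
  also have "\<dots> \<in> O' V W n"
    by (intro O'_sum O'_scale left_right_xmon_commute) simp
  finally show ?thesis .
qed

text \<open>
  The second half of \<open>lact_product\<close> for \<open>h = (1+x)^(-1)\<close>. Rewriting the kernels \<open>x^i (1+x)^n\<close> for \<open>u\<close>
  in terms of \<open>x^r (1+x)^(-1)\<close> multiplies the generating series \<open>rkernel_series\<close> of the kernels
  for \<open>v\<close> by \<open>(1+y)^(n+1)\<close>. Of the resulting coefficients, all but the one at \<open>r = 0\<close> are tail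
  kernels, and that one is the right kernel.
\<close>

lemma comm_product_tail_kernels:
  "\<forall>\<^sub>F I in sequentially. (\<Sum>i<I. wres V W (fps_nth (rkernel_series n) i) v
      (wres V W (xmon (int i) (int n)) u w))
     - wres V W (rkernel n) v (wres V W (xmon 0 (-1)) u w) \<in> O' V W n"
  using wres_eventually_zero[of "-1" u w] eventually_gt_at_top[of 0]
proof eventually_elim
  case (elim I)
  define y where "y r = wres V W (xmon (int r) (-1)) u w" for r
  define b :: "nat \<Rightarrow> complex" where "b s = of_nat ((n + 1) choose s)" for s
  define e where "e i s = smul W (b s) (wres V W (fps_nth (rkernel_series n) i) v (y (i + s)))" for i s
  have y0: "y r = 0" if "r \<ge> I" for r using elim that by (simp add: y_def)
  have "wres V W (fps_nth (rkernel_series n) i) v (wres V W (xmon (int i) (int n)) u w)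
      = (\<Sum>s<I - i. e i s)" if "i < I" for i
  proof -
    have "wres V W (xmon (int i) (int n)) u w = (\<Sum>s\<le>n+1. smul W (b s) (y (i + s)))"
      using xmon_expand[of "int i" "-1" "n + 1"]
          by (simp only: b_def y_def flip: wres_scale_kernel kernel.sum) simp
    \<comment> \<open>As \<open>y\<close> vanishes from \<open>I\<close> on, the range of \<open>s\<close> can be chosen to make \<open>i + s < I\<close> a triangle.\<close>
    also have "\<dots> = (\<Sum>s<I - i. smul W (b s) (y (i + s)))"
    proof (rule sum.mono_neutral_cong)
      fix s assume "s \<in> {..n + 1} - {..<I - i}"
      then have "I \<le> i + s" by auto
      then show "smul W (b s) (y (i + s)) = 0" by (simp add: y0)
    qed (auto simp: b_def binomial_eq_0)
    finally show ?thesis by (simp only: e_def wvec.sum wres_scale)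
  qed
  then have "(\<Sum>i<I. wres V W (fps_nth (rkernel_series n) i) v (wres V W (xmon (int i) (int n)) u w))
      = (\<Sum>i<I. \<Sum>s<I - i. e i s)"
    by simp
  also have "\<dots> = (\<Sum>(i, s)\<in>{(i, s). i + s < I}. e i s)"
  proof -
    have "{(i, s). i + s < I} = (SIGMA i:{..<I}. {..<I - i})" by auto
    then show ?thesis by (simp add: sum.Sigma)
  qed
  also have "\<dots> = (\<Sum>r<I. \<Sum>i\<le>r. e i (r - i))"
    by (rule sum.triangle_reindex)
  also have "\<dots> = (\<Sum>r<I. wres V W (fps_nth (rkernel_lift n) r) v (y r))"
  proof (rule sum.cong[OF refl])
    fix r
    have "fps_nth (rkernel_lift n) r = (\<Sum>i\<le>r. fls_const (b (r - i)) * fps_nth (rkernel_series n) i)"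
      unfolding rkernel_lift_def fps_mult_nth one_plus_fps_X_power_nth b_def atLeast0AtMost
          by (simp only: mult.commute)
    then show "(\<Sum>i\<le>r. e i (r - i)) = wres V W (fps_nth (rkernel_lift n) r) v (y r)"
      by (simp add: e_def kernel.sum wres_scale_kernel)
  qed
  also have "\<dots> = wres V W (fps_nth (rkernel_lift n) 0) v (y 0)
      + (\<Sum>r\<in>{1..<I}. wres V W (fps_nth (rkernel_lift n) r) v (y r))"
    using elim by (simp add: lessThan_atLeast0 sum.atLeast_Suc_lessThan)
  finally have "(\<Sum>i<I. wres V W (fps_nth (rkernel_series n) i) v (wres V W (xmon (int i) (int n)) u w))
     - wres V W (rkernel n) v (wres V W (xmon 0 (-1)) u w)
         = (\<Sum>r\<in>{1..<I}. wres V W (fps_nth (rkernel_lift n) r) v (y r))"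
    by (simp add: rkernel_lift_0 y_def)
  also have "\<dots> \<in> O' V W n"
  proof (rule O'_sum)
    fix r assume "r \<in> {1..<I}"
    then obtain q where "r = Suc q" by (cases r) auto
    then show "wres V W (fps_nth (rkernel_lift n) r) v (y r) \<in> O' V W n"
        by (simp add: wres_tail_kernels rkernel_lift_Suc_tail_kernels)
  qed
  finally show ?case .
qed

lemma comm_lact:
  "wres V W (xmon 0 (-1)) (wres V V (lkernel n) u v) w - wres V W (lkernel n) u
      (wres V W (xmon 0 (-1)) v w)
    - wres V W (rkernel n) v (wres V W (xmon 0 (-1)) u w) \<in> O' V W n"
proof -
  have "\<forall>\<^sub>F I in sequentially. wres V W (xmon 0 (-1)) (wres V V (lkernel n) u v) w - wres V W
      (lkernel n) u (wres V W (xmon 0 (-1)) v w)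
    - wres V W (rkernel n) v (wres V W (xmon 0 (-1)) u w) \<in> O' V W n"
    using lact_product[of "xmon 0 (-1)" n u v w] comm_product_tail_kernels[of n v u w]
  proof eventually_elim
    case (elim I)
    have "(\<Sum>m=0..n. \<Sum>i<I. smul W (act_coeff n m * (-1) ^ (n + m) *
        ((-1) ^ i * (of_int (- int n - int m - 1) gchoose i)))
        (wres V W (xmon 0 (-1) * xmon (- int n - int m - 1 - int i) (int m)) v
            (wres V W (xmon (int i) (int n)) u w)))
      = (\<Sum>i<I. wres V W (fps_nth (rkernel_series n) i) v (wres V W (xmon (int i) (int n)) u w))"
      unfolding rkernel_series_nth kernel.sum wres_scale_kernel by (rule sum.swap)
    with O'_add[OF elim] show ?case by simp
  qed
  then show ?thesis by simp
qed

text \<open>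
  Write the right actions as left actions minus commutator operators. Associativity of the
  left action, \<open>comm_lact\<close> and the commutation of left and right actions then add up to the
  claim.
\<close>

lemma ract_assoc:
  "wres V W (rkernel n) (wres V V (lkernel n) u v) w - wres V W (rkernel n) v
      (wres V W (rkernel n) u w) \<in> O' V W n"
proof -
  let ?L = "wres V W (lkernel n)" and ?R = "wres V W (rkernel n)" and ?C = "wres V W (xmon 0 (-1))"
  have "?R (wres V V (lkernel n) u v) w - ?R v (?R u w)
    = (?L (wres V V (lkernel n) u v) w - ?L u (?L v w))
      - (?C (wres V V (lkernel n) u v) w - ?L u (?C v w) - ?R v (?C u w))
      - (?R v (?L u w) - ?L u (?R v w))"
  proof -
    have "?R v (?R u w) = ?R v (?L u w) - ?R v (?C u w)"
      by (simp only: rkernel_eq[of n u] wvec.diff)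
    moreover have "?L u (?R v w) = ?L u (?L v w) - ?L u (?C v w)"
      by (simp only: rkernel_eq[of n v] wvec.diff)
    ultimately show ?thesis using rkernel_eq[of n "wres V V (lkernel n) u v" w] by simp
  qed
  also have "\<dots> \<in> O' V W n"
    by (intro O'_diff lact_assoc comm_lact left_right_commute)
  finally show ?thesis .
qed

end

section \<open>The ideal O_n(V) and the unit\<close>

context voa
begin

text \<open>
  As the conformal vector has weight \<open>2\<close>, its commutator operator is the residue of
  \<open>(1+x) Y(\<omega>,x)\<close>.
\<close>

lemma Lsum_eq: "adj.Lsum v = wres V V (xmon 0 (-1)) (conf V) v"
proof -
  have "wres V V (xmon 0 (-1)) (conf V) v = res_Y V (xmon 0 0 + xmon 1 0) (conf V) v"
    unfolding adj.wres_homogeneous[OF conf_weight] xmon_mult using xmon_split[of 0 0] by simp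
  also have "\<dots> = adj.Lsum v"
    unfolding res_Y_add_kernel res_Y_monom adj.Lsum_def by (simp add: Lop_def)
  finally show ?thesis by simp
qed

lemma O_n_eq: "O_n V n = W.span (range adj.Lsum \<union> O'_gens V V n)"
  by (simp add: O_n_def adj.Lsum_def full_SetCompr_eq)

lemma O_n_add: "x \<in> O_n V n \<Longrightarrow> y \<in> O_n V n \<Longrightarrow> x + y \<in> O_n V n"
  and O_n_diff: "x \<in> O_n V n \<Longrightarrow> y \<in> O_n V n \<Longrightarrow> x - y \<in> O_n V n"
  and O_n_minus: "x \<in> O_n V n \<Longrightarrow> - x \<in> O_n V n"
  unfolding O_n_def by (blast intro: W.span_add W.span_diff W.span_neg)+

lemma Lsum_O_n: "adj.Lsum v \<in> O_n V n"
  unfolding O_n_eq by (rule W.span_base) simp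

lemma O'_subset_O_n: "O' V V n \<subseteq> O_n V n"
  unfolding O_n_def O'_def by (rule W.span_mono) auto

lemma O_n_induct [consumes 1, case_names add Lsum O']:
  assumes "x \<in> O_n V n"
    and "\<And>x y. P x \<Longrightarrow> P y \<Longrightarrow> P (x + y)"
    and "\<And>v. P (adj.Lsum v)"
    and "\<And>x. x \<in> O' V V n \<Longrightarrow> P x"
  shows "P x"
  using assms(1) unfolding O_n_eq
proof (induction rule: W.span_induct_alt)
  case base
  show ?case by (rule assms(4)[OF adj.O'_zero])
next
  case (step c x y)
  have "P (smul V c x)"
  proof (cases "x \<in> O'_gens V V n")
    case True
    then show ?thesis unfolding O'_def by (intro assms(4)) (simp add: O'_def W.span_base W.span_scale)
  next
    case False
    then obtain v where "x = adj.Lsum v" using step by auto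
    then have "smul V c x = adj.Lsum (smul V c v)" by (simp add: Lsum_eq adj.wres_scale)
    then show ?thesis by (simp add: assms(3))
  qed
  then show ?case by (rule assms(2)[OF _ step(2)])
qed

text \<open>
  On the generators \<open>(L(-1)+L(0))v\<close> use that \<open>L(-1)+L(0)\<close> is a derivation.
\<close>

lemma lact_O_n:
  assumes "x \<in> O_n V n"
  shows "wres V V (lkernel n) u x \<in> O_n V n"
  using assms
proof (induction rule: O_n_induct)
  case (add x y)
  then show ?case by (simp add: adj.wres_add O_n_add)
next
  case (Lsum v)
  have "wres V V (lkernel n) u (adj.Lsum v) = adj.Lsum (wres V V (lkernel n) u v) - wres V V
      (lkernel n) (adj.Lsum u) v"
    using adj.comm_derivation[of "lkernel n" "conf V" u v] by (simp add: Lsum_eq)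
  then show ?case using subsetD[OF O'_subset_O_n adj.lact_Lsum[of n u v]]
      by (simp add: O_n_diff Lsum_O_n)
next
  case (O' x)
  then show ?case using adj.lact_O' O'_subset_O_n by blast
qed

text \<open>
  The left kernel is \<open>x^(-1)\<close>, which gives \<open>v\<close> by the creation property, plus a derivative, as its
  residue is \<open>1\<close>. By \<open>wres_Lsum\<close> a derivative kernel amounts to replacing \<open>v\<close> by \<open>(L(-1)+L(0))v\<close>.
  Since \<open>L(-1)+L(0)\<close> is a derivation that kills the vacuum, the result is in its image.
\<close>

lemma lact_vac_right: "wres V V (lkernel n) v (vac V) - v \<in> O_n V n"
proof -
  have id: "wres V V (xmon (-1) 0) v (vac V) = v"
  proof (induction v rule: homogeneous_induct)
    case (homogeneous k v)
    have "res_Y V (xmon (-1) k - xmon (-1) 0) v (vac V) = 0"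
    proof (rule res_Y_eq_0)
      fix i assume "fls_nth (xmon (-1) k - xmon (-1) 0) i \<noteq> 0"
      then have "i \<ge> 0" by (cases "i = -1") (auto simp: xmon_nth split: if_splits)
      then show "mode V v i (vac V) = 0" by (rule creation)
    qed
    moreover have "res_Y V (xmon (-1) k) v (vac V) = res_Y V
        ((xmon (-1) k - xmon (-1) 0) + xmon (-1) 0) v (vac V)"
      by simp
    ultimately show ?case
      unfolding adj.wres_homogeneous[OF homogeneous] xmon_mult
      by (simp only: res_Y_add_kernel) (simp add: res_Y_monom creation_lim)
  next
    case (add u v)
    then show ?case by (simp add: adj.wres_add_state)
  qed
  \<comment> \<open>The antiderivative exists because the residue is \<open>1 - 1 = 0\<close>.\<close>
  define q where "q = fls_integral (lkernel n - xmon (-1) 0)"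
  define g where "g = xmon 0 (-1) * q"
  have "fls_deriv q = lkernel n - xmon (-1) 0"
    unfolding q_def by (rule fls_deriv_fls_integral) (simp add: lkernel_residue xmon_monom_nth)
  moreover have "xmon 0 1 * g = q" by (simp add: g_def xmon_mult flip: mult.assoc)
  ultimately have "wres V V (lkernel n) v (vac V) - v = - wres V V g (adj.Lsum v) (vac V)"
    by (simp only: adj.wres_Lsum adj.kernel.diff id minus_minus)
  also have "\<dots> = - adj.Lsum (wres V V g v (vac V))"
  proof -
    have "adj.Lsum (vac V) = 0" by (simp add: adj.Lsum_def Lop_def creation)
    then show ?thesis using adj.comm_derivation[of g "conf V" v "vac V"]
        by (simp add: Lsum_eq adj.wvec.zero)
  qed
  also have "\<dots> \<in> O_n V n" by (intro O_n_minus Lsum_O_n)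
  finally show ?thesis .
qed

end

context voa_module
begin

lemma lact_left_O_n: "x \<in> O_n V n \<Longrightarrow> wres V W (lkernel n) x w \<in> O' V W n"
proof (induction rule: V.O_n_induct)
  case (add x y)
  then show ?case by (simp add: wres_add_state O'_add)
next
  case (Lsum v)
  have "V.adj.Lsum v = Lsum v" by (simp add: V.adj.Lsum_def Lsum_def)
  then show ?case by (simp add: lact_Lsum)
qed (rule lact_left_O')

lemma ract_left_O_n: "x \<in> O_n V n \<Longrightarrow> wres V W (rkernel n) x w \<in> O' V W n"
proof (induction rule: V.O_n_induct)
  case (add x y)
  then show ?case by (simp add: wres_add_state O'_add)
next
  case (Lsum v)
  have "V.adj.Lsum v = Lsum v" by (simp add: V.adj.Lsum_def Lsum_def)
  then show ?case by (simp add: rkernel_eq lact_Lsum comm_Lsum)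
qed (simp add: rkernel_eq O'_diff lact_left_O')

lemma lact_vac: "wres V W (lkernel n) (vac V) w = w"
  by (simp add: wres_homogeneous[OF V.vac_weight] res_Y_vac lkernel_residue)

lemma ract_vac: "wres V W (rkernel n) (vac V) w = w"
proof -
  have "wres V W (xmon 0 (-1)) (vac V) w = 0"
    by (simp add: wres_homogeneous[OF V.vac_weight] res_Y_vac xmon_nth)
  then show ?thesis by (simp add: rkernel_eq lact_vac)
qed

end

section \<open>Quotients\<close>

locale coset_space = vector_space s for s :: "complex \<Rightarrow> 'a \<Rightarrow> 'a::ab_group_add" +
  fixes S :: "'a set"
  assumes sub: "subspace S"
begin

lemma coset_eq: "x +o S = y +o S \<longleftrightarrow> x - y \<in> S"
proof
  assume "x +o S = y +o S"
  moreover have "x \<in> x +o S" using set_plus_intro2[OF subspace_0[OF sub], of x] by simp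
  ultimately show "x - y \<in> S" by (simp add: set_minus_plus)
next
  assume xy: "x - y \<in> S"
  have "z - x \<in> S \<longleftrightarrow> z - y \<in> S" for z
    using subspace_add[OF sub _ xy, of "z - x"] subspace_diff[OF sub _ xy, of "z - y"] by auto
  then show "x +o S = y +o S" by (auto simp flip: set_minus_plus)
qed

lemma coset_self: "x \<in> x +o S"
  using set_plus_intro2[OF subspace_0[OF sub], of x] by simp

lemma induced1_coset: "induced1 S (s c) (x +o S) = s c x +o S"
proof -
  have "s c y +o S = s c x +o S" if "y \<in> x +o S" for y
    using subspace_scale[OF sub, of "y - x" c] that
    by (simp add: coset_eq scale_right_diff_distrib set_minus_plus)
  then show ?thesis
    unfolding induced1_def using coset_self[of x] by blast
qed

lemma induced2_plus: "induced2 S (+) (x +o S) (y +o S) = (x + y) +o S"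
proof -
  have "(z + w) +o S = (x + y) +o S" if "z \<in> x +o S" "w \<in> y +o S" for z w
  proof -
    have "(z - x) + (w - y) \<in> S"
      using that by (intro subspace_add[OF sub]) (simp_all add: set_minus_plus)
    then show ?thesis by (simp add: coset_eq algebra_simps)
  qed
  then show ?thesis
    unfolding induced2_def using coset_self[of x] coset_self[of y] by blast
qed

text \<open>
  The multiplicative fields are arbitrary, so that the lemma serves both for \<open>A_n\<close> and for \<open>A'\<close>.
\<close>

lemma module_quotient_update:
  "module (ring_of_type_algebra :: complex ring) ((quotient_space s S)\<lparr>monoid.mult := f, one := e\<rparr>)"
  (is "module ?K ?M")
proof (rule moduleI)
  show "cring ?K" by (rule cring_from_type_algebra)
  show "abelian_group ?M"
  proof (rule abelian_groupI)
    fix x assume "x \<in> carrier ?M"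
    then obtain v where "x = v +o S" by (auto simp: quotient_space_def)
    then show "\<exists>y\<in>carrier ?M. y \<oplus>\<^bsub>?M\<^esub> x = \<zero>\<^bsub>?M\<^esub>"
      by (intro bexI[of _ "(- v) +o S"])
          (simp_all add: quotient_space_def induced2_plus del: set_zero_plus)
  next
    fix x assume "x \<in> carrier ?M"
    then obtain v where "x = v +o S" by (auto simp: quotient_space_def)
    then show "\<zero>\<^bsub>?M\<^esub> \<oplus>\<^bsub>?M\<^esub> x = x"
      by (simp add: quotient_space_def induced2_plus del: set_zero_plus)
  qed (auto simp: quotient_space_def induced2_plus ac_simps simp del: set_zero_plus)
qed (auto simp: quotient_space_def ring_of_type_algebra_def induced2_plus induced1_coset
      scale_left_distrib scale_right_distrib)

lemma module_quotient: "module (ring_of_type_algebra :: complex ring) (quotient_space s S)"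
  using module_quotient_update[of undefined undefined] by (simp add: quotient_space_def)

end

text \<open>
  A biadditive map that sends \<open>P\<close> in its first argument and \<open>Q\<close> in its second into \<open>T\<close> descends to
  the quotients.
\<close>

lemma induced2_coset:
  assumes "coset_space s P" "coset_space s' Q" "coset_space s'' T"
    and add: "\<And>x x' y. f (x + x') y = f x y + f x' y" "\<And>x y y'. f x (y + y') = f x y + f x y'"
    and left: "\<And>x y. x \<in> P \<Longrightarrow> f x y \<in> T" and right: "\<And>x y. y \<in> Q \<Longrightarrow> f x y \<in> T"
  shows "induced2 T f (x +o P) (y +o Q) = f x y +o T"
proof -
  interpret P: coset_space s P by fact
  interpret Q: coset_space s' Q by fact
  interpret T: coset_space s'' T by fact
  have "f x' y' +o T = f x y +o T" if "x' \<in> x +o P" "y' \<in> y +o Q" for x' y'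
  proof -
    have "x' - x \<in> P" "y' - y \<in> Q" using that by (simp_all add: set_minus_plus)
    then have "f (x' - x) y' + f x (y' - y) \<in> T"
      by (intro T.subspace_add[OF T.sub] left right)
    moreover have "f x' y' = f (x' - x) y' + f x (y' - y) + f x y"
      using add(1)[of "x' - x" x y'] add(2)[of x "y' - y" y] by simp
    ultimately show ?thesis by (simp add: T.coset_eq)
  qed
  then show ?thesis
    unfolding induced2_def using P.coset_self[of x] Q.coset_self[of y] by blast
qed

context voa
begin

lemma coset_space_O_n: "coset_space (smul V) (O_n V n)"
  by unfold_locales (simp add: O_n_def W.subspace_span)

end

context voa_module
begin

lemma coset_space_O': "coset_space (smul W) (O' V W n)"
  by unfold_locales (simp add: O'_def W.subspace_span)

lemma lact_coset: "induced2 (O' V W n) (lact V W n) (v +o O_n V n) (w +o O' V W n) = lact V W n v w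
    +o O' V W n"
  by (rule induced2_coset[OF V.coset_space_O_n coset_space_O' coset_space_O'])
    (simp_all add: lact_eq_wres wres_add_state wres_add lact_left_O_n lact_O')

lemma ract_coset: "induced2 (O' V W n) (ract V W n) (w +o O' V W n) (v +o O_n V n) = ract V W n w v
    +o O' V W n"
  by (rule induced2_coset[OF coset_space_O' V.coset_space_O_n coset_space_O'])
    (simp_all add: ract_eq_wres wres_add_state wres_add ract_left_O_n ract_O')

end

context voa
begin

lemma mult_coset: "induced2 (O_n V n) (lact V V n) (u +o O_n V n) (v +o O_n V n) = lact V V n u v
    +o O_n V n"
proof (rule induced2_coset[OF coset_space_O_n coset_space_O_n coset_space_O_n])
  show "lact V V n u v \<in> O_n V n" if "u \<in> O_n V n" for u v
    using adj.lact_left_O_n[OF that] O'_subset_O_n by (auto simp: adj.lact_eq_wres)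
qed (simp_all add: adj.lact_eq_wres adj.wres_add_state adj.wres_add lact_O_n)

lemma A_n_simps:
  "carrier (A_n V n) = range (\<lambda>v. v +o O_n V n)"
  "(u +o O_n V n) \<otimes>\<^bsub>A_n V n\<^esub> (v +o O_n V n) = lact V V n u v +o O_n V n"
  "\<one>\<^bsub>A_n V n\<^esub> = vac V +o O_n V n"
  "(u +o O_n V n) \<oplus>\<^bsub>A_n V n\<^esub> (v +o O_n V n) = (u + v) +o O_n V n"
  "c \<odot>\<^bsub>A_n V n\<^esub> (u +o O_n V n) = smul V c u +o O_n V n"
  by (simp_all add: A_n_def quotient_space_def mult_coset coset_space.induced2_plus[OF coset_space_O_n]
    coset_space.induced1_coset[OF coset_space_O_n])

lemma assoc_algebra_A_n: "assoc_algebra (ring_of_type_algebra :: complex ring) (A_n V n)"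
proof -
  interpret O: coset_space "smul V" "O_n V n" by (rule coset_space_O_n)
  have M: "module (ring_of_type_algebra :: complex ring) (A_n V n)"
    unfolding A_n_def by (rule O.module_quotient_update)
  have "ring (A_n V n)"
  proof (rule ringI)
    show "abelian_group (A_n V n)" using M by (rule module.axioms)
    show "Group.monoid (A_n V n)"
    proof (rule monoidI)
      fix x y z assume "x \<in> carrier (A_n V n)" "y \<in> carrier (A_n V n)" "z \<in> carrier (A_n V n)"
      moreover have "lact V V n (lact V V n u v) w +o O_n V n = lact V V n u (lact V V n v w)
          +o O_n V n" for u v w
        using adj.lact_assoc[of n u v w] O'_subset_O_n by (auto simp only: O.coset_eq adj.lact_eq_wres)
      ultimately show "x \<otimes>\<^bsub>A_n V n\<^esub> y \<otimes>\<^bsub>A_n V n\<^esub> z = x \<otimes>\<^bsub>A_n V n\<^esub> (y \<otimes>\<^bsub>A_n V n\<^esub> z)"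
        by (auto simp only: A_n_simps)
    next
      fix x assume "x \<in> carrier (A_n V n)"
      moreover have "lact V V n v (vac V) +o O_n V n = v +o O_n V n" for v
        using lact_vac_right by (simp only: O.coset_eq adj.lact_eq_wres)
      ultimately show "x \<otimes>\<^bsub>A_n V n\<^esub> \<one>\<^bsub>A_n V n\<^esub> = x" by (auto simp only: A_n_simps)
    qed (auto simp: A_n_simps adj.lact_eq_wres adj.lact_vac)
  qed (auto simp: A_n_simps adj.lact_eq_wres adj.wres_add_state adj.wres_add)
  then show ?thesis
    using M by (intro assoc_algebra.intro assoc_algebra_axioms.intro)
      (auto simp: A_n_simps adj.lact_eq_wres adj.wres_scale_state adj.wres_scale)
qed

end

context voa_module
begin

lemma A'_simps:
  "carrier (A' V W n) = range (\<lambda>w. w +o O' V W n)"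
  "(x +o O' V W n) \<oplus>\<^bsub>A' V W n\<^esub> (y +o O' V W n) = (x + y) +o O' V W n"
  "c \<odot>\<^bsub>A' V W n\<^esub> (x +o O' V W n) = smul W c x +o O' V W n"
  by (simp_all add: A'_def quotient_space_def coset_space.induced2_plus[OF coset_space_O']
    coset_space.induced1_coset[OF coset_space_O'])

lemma bimodule_A':
  "bimodule ring_of_type_algebra (A_n V n) (A' V W n)
     (induced2 (O' V W n) (lact V W n)) (induced2 (O' V W n) (ract V W n))"
proof -
  interpret O: coset_space "smul W" "O' V W n" by (rule coset_space_O')
  have linear:
    "lact V W n (u + v) w = lact V W n u w + lact V W n v w"
    "lact V W n u (w + x) = lact V W n u w + lact V W n u x"
    "lact V W n (smul V c u) w = smul W c (lact V W n u w)"
    "lact V W n u (smul W c w) = smul W c (lact V W n u w)"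
    "lact V W n (vac V) w = w"
    "ract V W n w (u + v) = ract V W n w u + ract V W n w v"
    "ract V W n (w + x) u = ract V W n w u + ract V W n x u"
    "ract V W n w (smul V c u) = smul W c (ract V W n w u)"
    "ract V W n (smul W c w) u = smul W c (ract V W n w u)"
    "ract V W n w (vac V) = w" for u v w x c
    by (simp_all add: lact_eq_wres ract_eq_wres wres_add_state wres_add wres_scale_state wres_scale
      lact_vac ract_vac)
  have assoc:
    "lact V W n (lact V V n u v) w +o O' V W n = lact V W n u (lact V W n v w) +o O' V W n"
    "ract V W n w (lact V V n u v) +o O' V W n = ract V W n (ract V W n w u) v +o O' V W n"
    "ract V W n (lact V W n u w) v +o O' V W n = lact V W n u (ract V W n w v) +o O' V W n" for u v w
    unfolding O.coset_eq V.adj.lact_eq_wres lact_eq_wres ract_eq_wres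
    by (rule lact_assoc ract_assoc left_right_commute)+
  show ?thesis
  proof (intro bimodule.intro bimodule_axioms.intro V.assoc_algebra_A_n)
    show "module ring_of_type_algebra (A' V W n)"
      unfolding A'_def by (rule O.module_quotient)
  qed (auto simp: V.A_n_simps A'_simps lact_coset ract_coset linear assoc)
qed

end

theorem proposition3p15:
  fixes V :: "'v::ab_group_add voa_data"
    and W :: "('v, 'w::ab_group_add) weak_module_data"
    and n :: nat
  assumes "voa V" and "weak_module V W"
  shows "bimodule ring_of_type_algebra (A_n V n) (A' V W n)
           (induced2 (O' V W n) (lact V W n)) (induced2 (O' V W n) (ract V W n))
       \<and> (\<forall>v w. induced2 (O' V W n) (lact V W n) (v +o O_n V n) (w +o O' V W n)
                = lact V W n v w +o O' V W n)
       \<and> (\<forall>v w. induced2 (O' V W n) (ract V W n) (w +o O' V W n) (v +o O_n V n)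
                = ract V W n w v +o O' V W n)"
proof -
  interpret voa_module V W by (rule voa_module.intro) fact+
  show ?thesis using bimodule_A' lact_coset ract_coset by blast
qed

end
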